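(* Let $0\le\alpha<\frac{\pi}{2}$ and let $A,B,C,D\in\Pi_n^{\alpha}$. Then for all $0\le t,\lambda\le1$, $$\mathfrak{R}\left(\lambda(A\sharp_tC)+(1-\lambda)(B\sharp_tD)\right)\le\sec^2\alpha\left(\mathfrak{R}\left(\lambda A+(1-\lambda)B\right)\sharp_t\,\mathfrak{R}\left(\lambda C+(1-\lambda)D\right)\right).$$
   Context: $\mathcal{M}_n$ is the algebra of $n\times n$ complex matrices, $\mathfrak{R}A=\frac{A+A^*}{2}$ is the real part of $A\in\mathcal{M}_n$, and for Hermitian $X,Y$, $X\le Y$ means that $Y-X$ is positive semidefinite. For $0\le\alpha<\pi/2$, $\Pi_n^{\alpha}$ is the set of $A\in\mathcal{M}_n$ such that for every unit vector $x\in\mathbb{C}^n$ the number $z=\langle Ax,x\rangle$ satisfies $\mathfrak{R}(z)>0$ and $|\mathfrak{I}(z)|\le(\tan\alpha)\,\mathfrak{R}(z)$. For accretive $X,Y\in\mathcal{M}_n$ (i.e. $\mathfrak{R}X,\mathfrak{R}Y$ positive definite) and $t\in[0,1]$, the weighted geometric mean is $X\sharp_tY=X^{1/2}\left(X^{-1/2}YX^{-1/2}\right)^tX^{1/2}$, with principal powers given by the holomorphic functional calculus on $\mathbb{C}\setminus(-\infty,0]$ (the spectrum of $X^{-1/2}YX^{-1/2}$ avoids $(-\infty,0]$). *)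

theory Defs
  imports "HOL-Complex_Analysis.Complex_Analysis"
begin

type_synonym 'n cmat = "complex ^ 'n ^ 'n"

definition adjoint_mat :: "'n::finite cmat \<Rightarrow> 'n cmat" where
  "adjoint_mat A = (\<chi> i j. cnj (A $ j $ i))"

definition hermitian_mat :: "'n::finite cmat \<Rightarrow> bool" where
  "hermitian_mat A \<longleftrightarrow> adjoint_mat A = A"

definition real_part :: "'n::finite cmat \<Rightarrow> 'n cmat" where
  "real_part A = (1 / 2) *\<^sub>R (A + adjoint_mat A)"

text \<open>The complex inner product, linear in the first argument; the library's \<open>inner\<close> on
  \<open>complex ^ 'n\<close> is only its real part. The library norm on \<open>complex ^ 'n\<close> is the Euclidean one,
  hence the norm induced by this inner product.\<close>

definition cinner :: "complex ^ 'n::finite \<Rightarrow> complex ^ 'n \<Rightarrow> complex" where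
  "cinner x y = (\<Sum>i\<in>UNIV. x $ i * cnj (y $ i))"

definition pos_semidef :: "'n::finite cmat \<Rightarrow> bool" where
  "pos_semidef A \<longleftrightarrow> hermitian_mat A \<and> (\<forall>x. 0 \<le> Re (cinner (A *v x) x))"

definition loewner_le :: "'n::finite cmat \<Rightarrow> 'n cmat \<Rightarrow> bool" where
  "loewner_le X Y \<longleftrightarrow> hermitian_mat X \<and> hermitian_mat Y \<and> pos_semidef (Y - X)"

definition sectorial :: "real \<Rightarrow> ('n::finite cmat) set" where
  "sectorial \<alpha> = {A. \<forall>x. norm x = 1 \<longrightarrow>
     0 < Re (cinner (A *v x) x) \<and>
     \<bar>Im (cinner (A *v x) x)\<bar> \<le> tan \<alpha> * Re (cinner (A *v x) x)}"

definition mat_spectrum :: "'n::finite cmat \<Rightarrow> complex set" where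
  "mat_spectrum A = {z. \<not> invertible (mat z - A)}"

text \<open>Admissible contours for the Cauchy integral of the holomorphic functional calculus: closed
  paths in \<open>U - mat_spectrum A\<close> that wind once around every point of the spectrum and do not
  wind around any point outside \<open>U\<close>. For connected open \<open>U\<close> containing the spectrum
  such a path exists, and by Cauchy's theorem the integral below does not depend on its choice.\<close>

definition fc_contour :: "complex set \<Rightarrow> 'n::finite cmat \<Rightarrow> (real \<Rightarrow> complex) \<Rightarrow> bool" where
  "fc_contour U A \<gamma> \<longleftrightarrow>
     valid_path \<gamma> \<and> pathfinish \<gamma> = pathstart \<gamma> \<and> path_image \<gamma> \<subseteq> U - mat_spectrum A \<and>
     (\<forall>z\<in>mat_spectrum A. winding_number \<gamma> z = 1) \<and>
     (\<forall>z. z \<notin> U \<longrightarrow> winding_number \<gamma> z = 0)"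

text \<open>\<open>f(A) = 1/(2 \<pi> i) \<integral> f(z) (z I - A)\<inverse> dz\<close>, taken entrywise; meaningful for connected open \<open>U\<close>
  containing the spectrum of \<open>A\<close> and \<open>f\<close> holomorphic on \<open>U\<close>.\<close>

definition holo_fc :: "complex set \<Rightarrow> (complex \<Rightarrow> complex) \<Rightarrow> 'n::finite cmat \<Rightarrow> 'n cmat" where
  "holo_fc U f A = (let \<gamma> = (SOME \<gamma>. fc_contour U A \<gamma>) in
     \<chi> i j. contour_integral \<gamma> (\<lambda>z. f z * matrix_inv (mat z - A) $ i $ j) / (2 * pi * \<i>))"

text \<open>On \<open>- \<real>\<^sub>\<le>\<^sub>0\<close>, the library's \<open>powr\<close> is the principal branch \<open>exp (s * Ln z)\<close>.\<close>

definition mat_powr :: "'n::finite cmat \<Rightarrow> real \<Rightarrow> 'n cmat" where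
  "mat_powr A s = holo_fc (- \<real>\<^sub>\<le>\<^sub>0) (\<lambda>z. z powr of_real s) A"

text \<open>Meaningful when the real parts of \<open>X\<close> and \<open>Y\<close> are positive definite.\<close>

definition geom_mean :: "real \<Rightarrow> 'n::finite cmat \<Rightarrow> 'n cmat \<Rightarrow> 'n cmat" where
  "geom_mean t X Y =
     mat_powr X (1/2) ** mat_powr (mat_powr X (-1/2) ** Y ** mat_powr X (-1/2)) t ** mat_powr X (1/2)"

end

theory Submission
  imports Defs "HOL-Computational_Algebra.Fundamental_Theorem_Algebra" "HOL-Real_Asymp.Real_Asymp"
begin

text \<open>The power function is a Beta mixture of Moebius maps: up to the normalising factor,
  \<open>z\<^sup>t = \<integral> s\<^sup>t\<^sup>-\<^sup>1 (1 - s)\<^sup>-\<^sup>t z / ((1 - s) z + s) ds\<close> over \<open>0 < s < 1\<close>. The functional calculus turns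
  this into an integral of the weighted harmonic means \<open>H\<^sub>s = ((1 - s) X\<inverse> + s Y\<inverse>)\<inverse>\<close>, so it suffices
  to treat these. If \<open>v = H\<^sub>s x\<close>, \<open>a = X\<inverse> v\<close> and \<open>b = Y\<inverse> v\<close>, then \<open>x = (1 - s) a + s b\<close> and
  \<open>\<langle>H\<^sub>s x, x\<rangle> = (1 - s) \<langle>X a, a'\<rangle> + s \<langle>Y b, b'\<rangle>\<close> for every decomposition \<open>x = (1 - s) a' + s b'\<close>.
  The sectorial Cauchy-Schwarz inequality
  \<open>2 Re \<langle>X a, a'\<rangle> \<le> Re \<langle>X a, a\<rangle> + sec\<^sup>2 \<alpha> Re \<langle>X a', a'\<rangle>\<close> then gives
  \<open>Re \<langle>H\<^sub>s x, x\<rangle> \<le> sec\<^sup>2 \<alpha> ((1 - s) Re \<langle>X a', a'\<rangle> + s Re \<langle>Y b', b'\<rangle>)\<close>.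
  The right-hand side is linear in \<open>(X, Y)\<close>, and for the optimal decomposition belonging to the pair
  of averaged real parts it is \<open>sec\<^sup>2 \<alpha>\<close> times the form of their harmonic mean.\<close>

section \<open>Polynomials in a matrix\<close>

no_notation fps_nth (infixl \<open>$\<close> 75)

text \<open>The obstacle is the functional calculus itself: \<open>holo_fc\<close> is an entrywise
  Cauchy integral over a contour picked by \<open>SOME\<close>, so even multiplicativity has to be
  earned. It is reduced to polynomials. \<open>A\<close> has an annihilating polynomial
  \<open>p\<close> whose roots are its eigenvalues; a function holomorphic on the slit plane splits
  as \<open>q + p * h\<close> with \<open>q\<close> a polynomial and \<open>h\<close> holomorphic,
  and since \<open>p\<close> times the resolvent is entire, the part \<open>p * h\<close> integrates
  to zero. Hence \<open>f(A) = q(A)\<close> for every admissible contour, and sums and products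
  become polynomial arithmetic. The constant arises as 1 + tan^2. Completing the square in the real
  part of the form of \<open>X\<close> is disturbed by the skew-Hermitian part of \<open>X\<close>,
  and the sector condition bounds the disturbance by tan^2 times the form at the competitor
  \<open>a'\<close>. The coefficient 1 left at \<open>a\<close> is essential: the terms in
  \<open>a\<close> and \<open>b\<close> recombine to the form of the harmonic mean at
  \<open>x\<close>, so one of its two copies on the left absorbs them and the factor falls on the
  competitor alone.\<close>

lemma mat_component: "mat c $ i $ j = (if i = j then c else 0)"
  by (simp add: mat_def)

lemma mat_mult_component [simp]:
  fixes A :: "'n::finite cmat"
  shows "(mat c ** A) $ i $ j = c * A $ i $ j"
proof -
  have "(mat c ** A) $ i $ j = (\<Sum>k\<in>UNIV. if i = k then c * A $ k $ j else 0)"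
    by (simp add: matrix_matrix_mult_def mat_def if_distrib [of "\<lambda>x. x * y" for y] cong: if_cong)
  then show ?thesis by (simp add: sum.delta)
qed

lemma mult_mat_component [simp]:
  fixes A :: "'n::finite cmat"
  shows "(A ** mat c) $ i $ j = c * A $ i $ j"
proof -
  have "A $ i $ k * mat c $ k $ j = (if k = j then c * A $ i $ k else 0)" for k
    by (simp add: mat_component)
  then show ?thesis
    by (simp add: matrix_matrix_mult_def)
qed

lemma mat_mult_commute:
  fixes A :: "'n::finite cmat"
  shows "A ** mat c = mat c ** A"
  by (simp add: vec_eq_iff)

lemma mat_of_real_mult: "mat (of_real r) ** M = r *\<^sub>R (M :: 'n::finite cmat)"
  by (simp add: vec_eq_iff scaleR_conv_of_real [where 'a = complex])

lemma mat_add: "mat (a + b) = mat a + (mat b :: 'n::finite cmat)"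
  by (simp add: vec_eq_iff mat_def)

lemma mat_diff: "mat (a - b) = mat a - (mat b :: 'n::finite cmat)"
  by (simp add: vec_eq_iff mat_def)

lemma mat_mult: "mat (a * b) = mat a ** (mat b :: 'n::finite cmat)"
  by (simp add: vec_eq_iff mat_component)

lemma cmat_add_rdistrib: "(A + B) ** C = A ** C + B ** (C :: 'n::finite cmat)"
  by (vector matrix_matrix_mult_def sum.distrib [symmetric] field_simps)

lemma cmat_diff_rdistrib: "(A - B) ** C = A ** C - B ** (C :: 'n::finite cmat)"
  by (vector matrix_matrix_mult_def sum_subtractf [symmetric] field_simps)

lemma cmat_diff_ldistrib: "A ** (B - C) = A ** B - A ** (C :: 'n::finite cmat)"
  by (vector matrix_matrix_mult_def sum_subtractf [symmetric] field_simps)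

lemma cmat_mult_zero_right [simp]: "A ** 0 = (0 :: 'n::finite cmat)"
  by (vector matrix_matrix_mult_def)

lemma cmat_mult_zero_left [simp]: "0 ** A = (0 :: 'n::finite cmat)"
  by (vector matrix_matrix_mult_def)

lemmas cmat_distribs =
  matrix_add_ldistrib cmat_add_rdistrib cmat_diff_ldistrib cmat_diff_rdistrib

lemma matrix_inv_left: "invertible A \<Longrightarrow> matrix_inv A ** A = mat 1"
  and matrix_inv_right: "invertible A \<Longrightarrow> A ** matrix_inv A = mat 1"
  unfolding invertible_def matrix_inv_def by (metis (mono_tags, lifting) someI_ex)+

lemma invertible_if_kernel_trivial:
  fixes A :: "'n::finite cmat"
  assumes "\<And>x. A *v x = 0 \<Longrightarrow> x = 0"
  shows "invertible A"
  using assms by (simp add: invertible_left_inverse matrix_left_invertible_ker)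

text \<open>Horner evaluation with \<open>**\<close>: the \<open>*\<close> of the vector type
  multiplies entrywise, so \<open>poly\<close> would compute something else. Scalars enter as
  \<open>mat a\<close>.\<close>

definition pmat :: "complex poly \<Rightarrow> 'n::finite cmat \<Rightarrow> 'n cmat" where
  "pmat p A = fold_coeffs (\<lambda>a M. mat a + A ** M) p 0"

lemma pmat_0 [simp]: "pmat 0 A = 0"
  by (simp add: pmat_def)

lemma pmat_pCons [simp]: "pmat (pCons a p) A = mat a + A ** pmat p A"
  by (cases "a = 0 \<and> p = 0") (auto simp: pmat_def fold_coeffs_pCons_coeff_not_0_eq
      fold_coeffs_pCons_not_0_0_eq)

lemma pmat_1 [simp]: "pmat 1 A = mat 1"
  by (simp add: one_pCons)

lemma pmat_smult: "pmat (smult c p) A = mat c ** pmat p A"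
proof (induction p)
  case (pCons a p)
  have "A ** (mat c ** M) = mat c ** (A ** M)" for M
    by (metis mat_mult_commute matrix_mul_assoc)
  then show ?case
    by (simp add: pCons.IH mat_mult cmat_distribs)
qed simp

lemma pmat_add: "pmat (p + q) A = pmat p A + pmat q A"
  by (induction p q rule: poly_induct2) (simp_all add: mat_add cmat_distribs)

lemma pmat_mult: "pmat (p * q) A = pmat p A ** pmat q A"
  by (induction p) (simp_all add: pmat_smult pmat_add cmat_distribs matrix_mul_assoc)

lemma pmat_sum: "pmat (sum f S) A = (\<Sum>i\<in>S. pmat (f i) A)"
  by (induction S rule: infinite_finite_induct) (simp_all add: pmat_add)

lemma pmat_linear_factor: "pmat [:-l, 1:] A = A - mat l"
proof -
  have "mat (- l) = - (mat l :: 'n::finite cmat)" by (simp add: vec_eq_iff mat_def)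
  then show ?thesis by simp
qed

text \<open>There are more powers of \<open>A\<close> than the real dimension of the matrix space,
  so a nontrivial real combination of them vanishes. Coinciding powers are set apart because linear
  dependence concerns the set of powers, which would then be too small.\<close>

lemma ex_annihilating_poly:
  fixes A :: "'n::finite cmat"
  obtains p where "p \<noteq> 0" "pmat p A = 0"
proof -
  define pw where "pw n = pmat (monom 1 n) A" for n
  define N where "N = Suc DIM('n cmat)"
  show ?thesis
  proof (cases "inj_on pw {..<N}")
    case False
    then obtain i j where ij: "i \<noteq> j" "pw i = pw j" by (auto simp: inj_on_def)
    define p :: "complex poly" where "p = monom 1 i + smult (-1) (monom 1 j)"
    have "coeff p i \<noteq> 0" using ij by (simp add: p_def)
    moreover have "pmat p A = pw i - pw j"
    proof -
      have "mat (-1) ** M = - M" for M :: "'n cmat" by (simp add: vec_eq_iff)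
      then show ?thesis by (simp add: p_def pmat_add pmat_smult pw_def del: smult_minus_left)
    qed
    ultimately show ?thesis using that[of p] ij by (metis coeff_0 diff_self)
  next
    case True
    then have "card (pw ` {..<N}) = N" by (simp add: card_image)
    then have "dependent (pw ` {..<N})"
      by (intro dependent_biggerset) (simp add: N_def)
    then obtain u v where u: "v \<in> pw ` {..<N}" "u v \<noteq> 0" "(\<Sum>v\<in>pw ` {..<N}. u v *\<^sub>R v) = 0"
      by (auto simp: dependent_finite)
    then obtain k where k: "k < N" "v = pw k" by auto
    define p :: "complex poly" where "p = (\<Sum>i<N. smult (of_real (u (pw i))) (monom 1 i))"
    have "coeff p k = of_real (u (pw k))"
      using k by (simp add: p_def coeff_sum if_distrib cong: if_cong)
    then have "p \<noteq> 0" using u k by auto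
    moreover have "pmat p A = (\<Sum>i<N. u (pw i) *\<^sub>R pw i)"
      by (simp add: p_def pmat_sum pmat_smult pw_def mat_of_real_mult)
    moreover have "(\<Sum>i<N. u (pw i) *\<^sub>R pw i) = 0"
      using u(3) True by (simp add: sum.reindex)
    ultimately show ?thesis using that by simp
  qed
qed

definition lin_prod :: "complex multiset \<Rightarrow> complex poly" where
  "lin_prod M = (\<Prod>l\<in>#M. [:-l, 1:])"

lemma lin_prod_empty [simp]: "lin_prod {#} = 1"
  and lin_prod_add [simp]: "lin_prod (add_mset l M) = [:-l, 1:] * lin_prod M"
  by (simp_all add: lin_prod_def)

lemma poly_lin_prod_eq_0_iff: "poly (lin_prod M) z = 0 \<longleftrightarrow> z \<in># M"
  by (induction M) (auto simp: algebra_simps)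

text \<open>Over the complex numbers an annihilating polynomial splits into linear factors. A factor
  belonging to some \<open>l\<close> outside the spectrum is, up to sign, an invertible matrix and
  can be cancelled.\<close>

lemma ex_annihilating_spectral_product:
  fixes A :: "'n::finite cmat"
  obtains M where "set_mset M \<subseteq> mat_spectrum A" "pmat (lin_prod M) A = 0"
proof -
  obtain p where p: "p \<noteq> 0" "pmat p A = 0" by (rule ex_annihilating_poly)
  have "smult (lead_coeff p) (lin_prod (proots p)) = p"
    unfolding lin_prod_def by (rule complex_poly_decompose_multiset)
  then have "mat (lead_coeff p) ** pmat (lin_prod (proots p)) A = 0"
    using p(2) by (metis pmat_smult)
  then have "pmat (lin_prod (proots p)) A = 0"
    using p(1) by (simp add: vec_eq_iff)
  moreover have "\<exists>N. set_mset N \<subseteq> mat_spectrum A \<and> pmat (lin_prod N) A = 0"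
    if "pmat (lin_prod M) A = 0" for M
    using that
  proof (induction "size M" arbitrary: M)
    case 0
    then show ?case by (intro exI[of _ "{#}"]) auto
  next
    case (Suc n)
    show ?case
    proof (cases "set_mset M \<subseteq> mat_spectrum A")
      case False
      then obtain l where l: "l \<in># M" "l \<notin> mat_spectrum A" by auto
      then obtain M' where M: "M = add_mset l M'" by (metis insert_DiffM)
      have inv: "invertible (mat l - A)" using l by (simp add: mat_spectrum_def)
      have "(mat l - A) ** pmat (lin_prod M') A = - ((A - mat l) ** pmat (lin_prod M') A)"
        by (simp add: cmat_distribs)
      also have "\<dots> = 0"
        using Suc.prems unfolding M lin_prod_add pmat_mult pmat_linear_factor by simp
      finally have "pmat (lin_prod M') A = 0"
        by (metis inv matrix_inv_left matrix_mul_assoc matrix_mul_lid cmat_mult_zero_right)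
      then show ?thesis using Suc M by auto
    qed (use Suc in auto)
  qed
  ultimately show ?thesis using that by metis
qed

text \<open>The matrix version of \<open>z - w\<close> dividing \<open>p(z) - p(w)\<close>; the
  recursion for \<open>Q\<close> comes from
  \<open>z p(z) - A p(A) = (z - A) p(z) + A (p(z) - p(A))\<close>. For annihilating \<open>p\<close>
  it exhibits the resolvent as \<open>Q / p\<close>.\<close>

lemma ex_poly_quotient:
  fixes A :: "'n::finite cmat"
  obtains Q where "\<And>i j. (\<lambda>z. Q z $ i $ j) holomorphic_on UNIV"
    "\<And>z. mat (poly p z) - pmat p A = (mat z - A) ** Q z"
proof -
  have "\<exists>Q. (\<forall>i j. (\<lambda>z. Q z $ i $ j) holomorphic_on UNIV) \<and>
      (\<forall>z. mat (poly p z) - pmat p A = (mat z - A) ** Q z)"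
  proof (induction p)
    case 0
    show ?case by (rule exI[of _ "\<lambda>_. 0"]) auto
  next
    case (pCons a p)
    then obtain Q where Q: "\<And>i j. (\<lambda>z. Q z $ i $ j) holomorphic_on UNIV"
      "\<And>z. mat (poly p z) - pmat p A = (mat z - A) ** Q z" by blast
    define Q' where "Q' z = mat (poly p z) + A ** Q z" for z
    have "(\<lambda>z. Q' z $ i $ j) holomorphic_on UNIV" for i j
      unfolding Q'_def matrix_matrix_mult_def
      by (cases "i = j") (auto simp: mat_component intro!: holomorphic_intros Q)
    moreover have "mat (poly (pCons a p) z) - pmat (pCons a p) A = (mat z - A) ** Q' z" for z
    proof -
      have c: "(mat z - A) ** (A ** X) = A ** ((mat z - A) ** X)" for X
        by (simp add: cmat_distribs matrix_mul_assoc mat_mult_commute)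
      have "mat (poly (pCons a p) z) - pmat (pCons a p) A
          = mat z ** mat (poly p z) - A ** pmat p A"
        by (simp add: mat_add mat_mult)
      also have "\<dots> = (mat z - A) ** mat (poly p z) + A ** (mat (poly p z) - pmat p A)"
        by (simp add: cmat_distribs)
      also have "\<dots> = (mat z - A) ** Q' z"
        by (simp add: Q'_def Q(2) c matrix_add_ldistrib)
      finally show ?thesis .
    qed
    ultimately show ?case by blast
  qed
  then show ?thesis using that by blast
qed

section \<open>The resolvent and the functional calculus\<close>

text \<open>For annihilating \<open>p\<close> the identity \<open>p(z) = (z - A) Q(z)\<close> makes
  the resolvent rational. It also makes \<open>z - A\<close> invertible wherever \<open>p\<close>
  does not vanish, so the roots, already confined to the spectrum, exhaust it; in particular the
  spectrum is finite and nonempty.\<close>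

lemma resolvent_quotient:
  fixes A :: "'n::finite cmat"
  obtains M Q where "M \<noteq> {#}" "set_mset M = mat_spectrum A" "pmat (lin_prod M) A = 0"
    "\<And>i j. (\<lambda>z. Q z $ i $ j) holomorphic_on UNIV"
    "\<And>z. z \<notin> mat_spectrum A \<Longrightarrow> mat (poly (lin_prod M) z) ** matrix_inv (mat z - A) = Q z"
proof -
  obtain M where M: "set_mset M \<subseteq> mat_spectrum A" "pmat (lin_prod M) A = 0"
    by (rule ex_annihilating_spectral_product)
  have "mat 1 \<noteq> (0 :: 'n cmat)"
    by (metis mat_component zero_index zero_neq_one)
  then have "M \<noteq> {#}" using M by auto
  obtain Q :: "complex \<Rightarrow> 'n cmat" where hol: "\<And>i j. (\<lambda>z. Q z $ i $ j) holomorphic_on UNIV"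
    and Q: "\<And>z. mat (poly (lin_prod M) z) - pmat (lin_prod M) A = (mat z - A) ** Q z"
    using ex_poly_quotient[of "lin_prod M" A] by metis
  have Q: "(mat z - A) ** Q z = mat (poly (lin_prod M) z)" for z
    using Q[of z] M by simp
  have "mat_spectrum A \<subseteq> set_mset M"
  proof
    fix z assume z: "z \<in> mat_spectrum A"
    show "z \<in># M"
    proof (rule ccontr)
      assume "z \<notin># M"
      then have nz: "poly (lin_prod M) z \<noteq> 0" by (simp add: poly_lin_prod_eq_0_iff)
      have "(mat z - A) ** (Q z ** mat (inverse (poly (lin_prod M) z))) = mat 1"
        using nz by (simp add: matrix_mul_assoc Q flip: mat_mult)
      then have "invertible (mat z - A)"
        using invertible_right_inverse by blast
      then show False using z by (simp add: mat_spectrum_def)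
    qed
  qed
  moreover have "mat (poly (lin_prod M) z) ** matrix_inv (mat z - A) = Q z"
    if "z \<notin> mat_spectrum A" for z
  proof -
    have "matrix_inv (mat z - A) ** ((mat z - A) ** Q z) = Q z"
      using that by (simp add: mat_spectrum_def matrix_inv_left matrix_mul_assoc)
    then show ?thesis by (simp add: Q mat_mult_commute)
  qed
  ultimately show ?thesis using that M \<open>M \<noteq> {#}\<close> hol by blast
qed

lemma finite_mat_spectrum: "finite (mat_spectrum A)"
  by (metis resolvent_quotient finite_set_mset)

lemma holomorphic_on_resolvent:
  "(\<lambda>z. matrix_inv (mat z - A) $ i $ j) holomorphic_on (- mat_spectrum A)"
proof -
  obtain M Q where M: "set_mset M = mat_spectrum A"
    and Q: "\<And>i j. (\<lambda>z. Q z $ i $ j) holomorphic_on UNIV"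
    "\<And>z. z \<notin> mat_spectrum A \<Longrightarrow> mat (poly (lin_prod M) z) ** matrix_inv (mat z - A) = Q z"
    using resolvent_quotient[of A] by metis
  have "(\<lambda>z. Q z $ i $ j / poly (lin_prod M) z) holomorphic_on (- mat_spectrum A)"
    by (intro holomorphic_intros holomorphic_on_subset[OF Q(1)])
       (auto simp: poly_lin_prod_eq_0_iff M)
  then show ?thesis
  proof (rule holomorphic_transform)
    fix z assume "z \<in> - mat_spectrum A"
    then show "Q z $ i $ j / poly (lin_prod M) z = matrix_inv (mat z - A) $ i $ j"
      using Q(2)[of z] M poly_lin_prod_eq_0_iff[of M z]
      by (metis ComplD mat_mult_component nonzero_mult_div_cancel_left)
  qed
qed

text \<open>Two distinct roots \<open>a\<close> and \<open>b\<close> are separated by partial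
  fractions into two products with one factor fewer. By induction their integrals coincide, since
  the path winds once around every root, and so they cancel. If all roots coincide and there are at
  least two, the integrand has a primitive.\<close>

lemma contour_integral_inverse_lin_prod:
  assumes \<gamma>: "valid_path \<gamma>" "pathfinish \<gamma> = pathstart \<gamma>"
    and wind: "\<And>l. l \<in># M \<Longrightarrow> l \<notin> path_image \<gamma> \<and> winding_number \<gamma> l = 1"
    and "M \<noteq> {#}"
  shows "((\<lambda>z. 1 / poly (lin_prod M) z) has_contour_integral
    (if size M = 1 then 2 * pi * \<i> else 0)) \<gamma>"
  using wind \<open>M \<noteq> {#}\<close>
proof (induction "size M" arbitrary: M rule: less_induct)
  case less
  obtain a M1 where M1: "M = add_mset a M1" using less.prems by (meson multiset_nonemptyE mset_add)
  have a: "a \<notin> path_image \<gamma>" "winding_number \<gamma> a = 1" using less.prems M1 by auto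
  consider "M1 = {#}" | "M1 \<noteq> {#}" "\<And>b. b \<in># M1 \<Longrightarrow> b = a" | b M2 where "M1 = add_mset b M2" "b \<noteq> a"
    by (metis mset_add)
  then show ?case
  proof cases
    case 1
    then show ?thesis
      using has_contour_integral_winding_number[OF \<gamma>(1) a(1)] a(2) M1 by simp
  next
    case 2
    have rep: "M1 = replicate_mset (size M1) a"
      using 2(2) by (simp add: set_mset_subset_singletonD subsetI)
    define n where "n = size M1"
    have n: "n > 0" using 2(1) by (simp add: n_def nonempty_has_size)
    have "lin_prod (replicate_mset k a) = [:-a, 1:] ^ k" for k
      by (induction k) auto
    then have "lin_prod M = [:-a, 1:] ^ Suc n"
      using rep unfolding M1 n_def by (metis lin_prod_add power_Suc)
    then have eq: "poly (lin_prod M) z = (z - a) ^ Suc n" for z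
      by (simp only: poly_power) simp
    have "((\<lambda>z. 1 / (z - a) ^ Suc n) has_contour_integral 0) \<gamma>"
    proof (rule Cauchy_theorem_primitive[where S = "- {a}"])
      fix z assume "z \<in> - {a}"
      then have z: "z - a \<noteq> 0" by simp
      have *: "((\<lambda>z. inverse (z - a)) has_field_derivative - (inverse (z - a) * 1 * inverse (z - a))) (at z within - {a})"
        using z by (intro DERIV_inverse' derivative_eq_intros) auto
      have "((\<lambda>z. - (1 / of_nat n) * inverse (z - a) ^ n) has_field_derivative
          - (1 / of_nat n) * (of_nat n * (- (inverse (z - a) * 1 * inverse (z - a)) * inverse (z - a) ^ (n - Suc 0))))
          (at z within - {a})"
        by (intro DERIV_cmult DERIV_power *)
      moreover have "- (1 / of_nat n) * (of_nat n * (- (inverse (z - a) * 1 * inverse (z - a)) * inverse (z - a) ^ (n - Suc 0)))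
          = 1 / (z - a) ^ Suc n"
      proof -
        have "- (1 / c) * (c * (- (w * 1 * w) * v)) = w * (w * v)" if "c \<noteq> 0" for c w v :: complex
          using that by simp
        then show ?thesis
          using n z by (cases n) (simp_all add: divide_inverse power_inverse del: of_nat_Suc)
      qed
      ultimately show "((\<lambda>z. - (1 / of_nat n) * inverse (z - a) ^ n) has_field_derivative 1 / (z - a) ^ Suc n)
          (at z within - {a})" by simp
    qed (use \<gamma> a in auto)
    moreover have "size M \<noteq> 1" using 2(1) by (simp add: M1)
    ultimately show ?thesis by (simp add: eq)
  next
    case (3 b M2)
    have ia: "((\<lambda>z. 1 / poly (lin_prod (add_mset x M2)) z) has_contour_integral
        (if M2 = {#} then 2 * pi * \<i> else 0)) \<gamma>" if "x = a \<or> x = b" for x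
    proof -
      have "\<And>l. l \<in># add_mset x M2 \<Longrightarrow> l \<notin> path_image \<gamma> \<and> winding_number \<gamma> l = 1"
        using less.prems(1) that by (auto simp: M1 3)
      then show ?thesis
        using less.hyps[of "add_mset x M2"] by (simp add: M1 3 del: lin_prod_add)
    qed
    have "((\<lambda>z. (1 / poly (lin_prod (add_mset a M2)) z - 1 / poly (lin_prod (add_mset b M2)) z) / (a - b))
       has_contour_integral ((if M2 = {#} then 2 * pi * \<i> else 0) - (if M2 = {#} then 2 * pi * \<i> else 0)) / (a - b)) \<gamma>"
      by (intro has_contour_integral_div has_contour_integral_diff ia) auto
    then have "((\<lambda>z. (1 / poly (lin_prod (add_mset a M2)) z - 1 / poly (lin_prod (add_mset b M2)) z) / (a - b))
       has_contour_integral 0) \<gamma>" by simp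
    then have "((\<lambda>z. 1 / poly (lin_prod M) z) has_contour_integral 0) \<gamma>"
    proof (rule has_contour_integral_eq)
      fix z assume z: "z \<in> path_image \<gamma>"
      have nz: "z - a \<noteq> 0" "z - b \<noteq> 0" "poly (lin_prod M2) z \<noteq> 0" "a - b \<noteq> 0"
        using less.prems(1) z 3(2) by (auto simp: M1 3(1) poly_lin_prod_eq_0_iff)
      have *: "(1 / (u * w) - 1 / (v * w)) / (v - u) = 1 / (u * (v * w))"
        if "u \<noteq> 0" "v \<noteq> 0" "w \<noteq> 0" "v - u \<noteq> 0" for u v w :: complex
        using that by (simp add: divide_simps)
      have "poly [:-x, 1:] z = z - x" for x by simp
      then show "(1 / poly (lin_prod (add_mset a M2)) z - 1 / poly (lin_prod (add_mset b M2)) z) / (a - b)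
          = 1 / poly (lin_prod M) z"
        using *[of "z - a" "z - b" "poly (lin_prod M2) z"] nz
        unfolding M1 3 lin_prod_add poly_mult by simp
    qed
    then show ?thesis by (simp add: M1 3)
  qed
qed

lemma resolvent_step:
  assumes "z \<notin> mat_spectrum A" "z \<noteq> l"
  shows "matrix_inv (mat z - A) = mat (1 / (z - l)) ** (mat 1 + (A - mat l) ** matrix_inv (mat z - A))"
proof -
  let ?R = "matrix_inv (mat z - A)"
  have "(mat z - A) ** ?R = mat 1"
    using assms by (simp add: mat_spectrum_def matrix_inv_right)
  moreover have "mat (z - l) ** ?R = (mat z - A) ** ?R + (A - mat l) ** ?R"
    by (simp add: mat_diff cmat_distribs)
  ultimately have "mat (1 / (z - l)) ** (mat (z - l) ** ?R) = mat (1 / (z - l)) ** (mat 1 + (A - mat l) ** ?R)"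
    by simp
  then show ?thesis
    using assms by (simp add: matrix_mul_assoc flip: mat_mult)
qed

lemma cmat_mult_component: "(A ** B) $ i $ j = (\<Sum>k\<in>UNIV. A $ i $ k * (B :: 'n::finite cmat) $ k $ j)"
  by (simp add: matrix_matrix_mult_def)

text \<open>Iterating \<open>R = (z - l)\<inverse> (1 + (A - l) R)\<close> over the roots \<open>l\<close> of the annihilating polynomial
  leaves only the integral of \<open>(z - l)\<inverse>\<close>: the remaining scalar terms have at least two linear
  factors in the denominator, and the last matrix term carries the factor \<open>\<Prod>(A - l) = 0\<close>.\<close>

lemma contour_integral_resolvent:
  fixes A :: "'n::finite cmat"
  assumes "fc_contour U A \<gamma>"
  shows "contour_integral \<gamma> (\<lambda>z. matrix_inv (mat z - A) $ i $ j) = 2 * pi * \<i> * mat 1 $ i $ j"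
proof -
  define R where "R z = matrix_inv (mat z - A)" for z
  have \<gamma>: "valid_path \<gamma>" "pathfinish \<gamma> = pathstart \<gamma>" "path_image \<gamma> \<subseteq> - mat_spectrum A"
    and wind: "\<And>l. l \<in> mat_spectrum A \<Longrightarrow> l \<notin> path_image \<gamma> \<and> winding_number \<gamma> l = 1"
    using assms by (auto simp: fc_contour_def)
  obtain M where M: "M \<noteq> {#}" "set_mset M = mat_spectrum A" "pmat (lin_prod M) A = 0"
    using resolvent_quotient[of A] by metis
  define T where "T K = (\<chi> i j. contour_integral \<gamma> (\<lambda>z. R z $ i $ j / poly (lin_prod K) z))" for K
  have int: "(\<lambda>z. R z $ i $ j / poly (lin_prod K) z) contour_integrable_on \<gamma>"
    if "set_mset K \<subseteq> mat_spectrum A" for K i j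
    unfolding R_def
  proof (rule contour_integrable_holomorphic_simple[where S = "- mat_spectrum A"])
    show "(\<lambda>z. matrix_inv (mat z - A) $ i $ j / poly (lin_prod K) z) holomorphic_on - mat_spectrum A"
      using that by (intro holomorphic_intros holomorphic_on_resolvent)
        (auto simp: poly_lin_prod_eq_0_iff)
  qed (use \<gamma> in \<open>auto simp: finite_imp_closed finite_mat_spectrum open_Compl\<close>)
  \<comment> \<open>\<open>add_mset l K\<close> is a single linear factor exactly when
    \<open>K\<close> is empty, and only then does the scalar term have a nonzero integral.\<close>
  have step: "T K = mat (if K = {#} then 2 * pi * \<i> else 0) + (A - mat l) ** T (add_mset l K)"
    if K: "set_mset K \<subseteq> mat_spectrum A" and l: "l \<in> mat_spectrum A" for K l
  proof -
    define L where "L = add_mset l K"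
    define c :: complex where "c = (if K = {#} then 2 * pi * \<i> else 0)"
    have L: "set_mset L \<subseteq> mat_spectrum A" using K l by (simp add: L_def)
    have J: "((\<lambda>z. 1 / poly (lin_prod L) z) has_contour_integral c) \<gamma>"
    proof -
      have "((\<lambda>z. 1 / poly (lin_prod L) z) has_contour_integral
          (if size L = 1 then 2 * pi * \<i> else 0)) \<gamma>"
        by (rule contour_integral_inverse_lin_prod[OF \<gamma>(1,2)]) (use wind L in \<open>auto simp: L_def\<close>)
      then show ?thesis
        by (simp add: L_def c_def del: lin_prod_add)
    qed
    have "T K $ i $ j = mat c $ i $ j + (\<Sum>k\<in>UNIV. (A - mat l) $ i $ k * T L $ k $ j)" for i j
    proof -
      have "((\<lambda>z. mat 1 $ i $ j * (1 / poly (lin_prod L) z)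
              + (\<Sum>k\<in>UNIV. (A - mat l) $ i $ k * (R z $ k $ j / poly (lin_prod L) z)))
          has_contour_integral (mat 1 $ i $ j * c + (\<Sum>k\<in>UNIV. (A - mat l) $ i $ k * T L $ k $ j))) \<gamma>"
        by (intro has_contour_integral_add has_contour_integral_lmul has_contour_integral_sum J)
           (auto simp: T_def intro!: has_contour_integral_integral int L)
      then have "((\<lambda>z. R z $ i $ j / poly (lin_prod K) z)
          has_contour_integral (mat 1 $ i $ j * c + (\<Sum>k\<in>UNIV. (A - mat l) $ i $ k * T L $ k $ j))) \<gamma>"
      proof (rule has_contour_integral_eq)
        fix z assume "z \<in> path_image \<gamma>"
        then have z: "z \<notin> mat_spectrum A" "z - l \<noteq> 0" using \<gamma> l by auto
        have "R z $ i $ j = 1 / (z - l) * (mat 1 $ i $ j + (\<Sum>k\<in>UNIV. (A - mat l) $ i $ k * R z $ k $ j))"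
          using arg_cong[OF resolvent_step[of z A l], of "\<lambda>X. X $ i $ j"] z
          by (simp add: R_def matrix_matrix_mult_def [of "A - mat l"])
        moreover have "poly (lin_prod L) z = (z - l) * poly (lin_prod K) z"
          by (simp add: L_def algebra_simps)
        ultimately show "mat 1 $ i $ j * (1 / poly (lin_prod L) z)
              + (\<Sum>k\<in>UNIV. (A - mat l) $ i $ k * (R z $ k $ j / poly (lin_prod L) z))
            = R z $ i $ j / poly (lin_prod K) z"
          by (simp add: sum_divide_distrib [symmetric] add_divide_distrib)
      qed
      then show ?thesis
        by (simp add: T_def contour_integral_unique mat_component)
    qed
    then show ?thesis
      by (simp add: vec_eq_iff matrix_matrix_mult_def L_def c_def)
  qed
  have iter: "T K = pmat (lin_prod N) A ** T (N + K)"
    if "K \<noteq> {#}" "set_mset K \<subseteq> mat_spectrum A" "set_mset N \<subseteq> mat_spectrum A" for K N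
    using that
  proof (induction N arbitrary: K)
    case (add l N)
    have "T (add_mset l K) = pmat (lin_prod N) A ** T (N + add_mset l K)"
      using add.prems by (intro add.IH) auto
    moreover have "T K = (A - mat l) ** T (add_mset l K)"
      using step[of K l] add.prems by simp
    ultimately show ?case
      by (simp only: lin_prod_add pmat_mult pmat_linear_factor matrix_mul_assoc
          union_mset_add_mset_left union_mset_add_mset_right)
  qed simp
  \<comment> \<open>Scalar terms vanish only once the denominator is nontrivial, so one root
    \<open>l\<close> is spent to produce \<open>2 * pi * \<i>\<close> before the whole of
    \<open>M\<close> is applied to what remains.\<close>
  obtain l where l: "l \<in> mat_spectrum A" using M by (metis multiset_nonemptyE)
  have "T {#} = mat (2 * pi * \<i>) + (A - mat l) ** T {#l#}"
    using step[of "{#}" l] l by simp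
  moreover have "T {#l#} = 0"
    using iter[of "{#l#}" M] l M by simp
  ultimately have "T {#} = mat (2 * pi * \<i>)" by simp
  then have "T {#} $ i $ j = mat (2 * pi * \<i>) $ i $ j" by simp
  then show ?thesis by (auto simp: T_def R_def mat_component)
qed

text \<open>One root is split off at a time: the difference quotient \<open>g\<close> of
  \<open>f\<close> at \<open>l\<close> has a removable singularity,
  \<open>f z = f l + (z - l) * g z\<close>, and the recursion continues with \<open>g\<close>.
  Repeated roots are thereby covered.\<close>

lemma hermite_interpolation:
  assumes "f holomorphic_on U" "open U"
  obtains q h where "h holomorphic_on U"
    "\<And>z. z \<in> U \<Longrightarrow> f z = poly q z + poly (lin_prod M) z * h z"
proof -
  have "\<exists>q h. h holomorphic_on U \<and> (\<forall>z\<in>U. f z = poly q z + poly (lin_prod M) z * h z)"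
    using assms(1)
  proof (induction M arbitrary: f)
    case empty
    then show ?case by (intro exI[of _ 0] exI[of _ f]) auto
  next
    case (add l M)
    define g where "g z = (if z = l then deriv f l else (f z - f l) / (z - l))" for z
    have "g holomorphic_on U"
      unfolding g_def using add.prems assms(2) by (rule pole_lemma_open)
    then obtain q h where qh: "h holomorphic_on U"
      "\<And>z. z \<in> U \<Longrightarrow> g z = poly q z + poly (lin_prod M) z * h z"
      using add.IH by blast
    have "f z = poly ([:f l:] + [:-l, 1:] * q) z + poly (lin_prod (add_mset l M)) z * h z"
      if "z \<in> U" for z
    proof -
      have "f z = f l + (z - l) * g z" by (simp add: g_def)
      then show ?thesis using qh(2)[OF that] by (simp add: algebra_simps)
    qed
    then show ?case using qh(1) by blast
  qed
  then show ?thesis using that by blast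
qed

text \<open>\<open>p\<close> is fixed before \<open>f\<close>, so the representations of two
  functions share it and combine to one of their sum or product. The contour in the second clause is
  arbitrary, which yields independence of the contour as a by-product.\<close>

lemma holo_calculus:
  fixes A :: "'n::finite cmat"
  assumes "open U"
  obtains p where
    "\<And>f. f holomorphic_on U \<Longrightarrow> \<exists>q h. h holomorphic_on U \<and> (\<forall>z\<in>U. f z = poly q z + poly p z * h z)"
    "\<And>f q h \<gamma>. fc_contour U A \<gamma> \<Longrightarrow> h holomorphic_on U \<Longrightarrow> \<forall>z\<in>U. f z = poly q z + poly p z * h z \<Longrightarrow>
      (\<chi> i j. contour_integral \<gamma> (\<lambda>z. f z * matrix_inv (mat z - A) $ i $ j) / (2 * pi * \<i>)) = pmat q A"
proof -
  obtain M Q where M: "set_mset M = mat_spectrum A" "pmat (lin_prod M) A = 0"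
    and Q: "\<And>i j. (\<lambda>z. Q z $ i $ j) holomorphic_on UNIV"
    "\<And>z. z \<notin> mat_spectrum A \<Longrightarrow> mat (poly (lin_prod M) z) ** matrix_inv (mat z - A) = Q z"
    using resolvent_quotient[of A] by metis
  have main: "(\<chi> i j. contour_integral \<gamma> (\<lambda>z. f z * matrix_inv (mat z - A) $ i $ j) / (2 * pi * \<i>)) = pmat q A"
    if fc: "fc_contour U A \<gamma>" and h: "h holomorphic_on U"
      and f: "\<forall>z\<in>U. f z = poly q z + poly (lin_prod M) z * h z" for \<gamma> f q h
  proof -
    define R where "R z = matrix_inv (mat z - A)" for z
    have \<gamma>: "valid_path \<gamma>" "pathfinish \<gamma> = pathstart \<gamma>" "path_image \<gamma> \<subseteq> - mat_spectrum A"
      "path_image \<gamma> \<subseteq> U" "\<And>z. z \<notin> U \<Longrightarrow> winding_number \<gamma> z = 0"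
      using fc by (auto simp: fc_contour_def)
    have zero: "(g has_contour_integral 0) \<gamma>" if "g holomorphic_on U" for g
      using Cauchy_theorem_global[OF assms that] \<gamma> by auto
    have inv: "(mat z - A) ** R z = mat 1" if "z \<in> path_image \<gamma>" for z
      using that \<gamma>(3) unfolding R_def by (intro matrix_inv_right) (auto simp: mat_spectrum_def)
    \<comment> \<open>\<open>z R(z) = 1 + A R(z)\<close> drives the induction over the coefficients;
      the entire scalar term that it leaves behind integrates to zero.\<close>
    have polys: "\<forall>i j. ((\<lambda>z. poly q z * R z $ i $ j) has_contour_integral (2 * pi * \<i> * pmat q A $ i $ j)) \<gamma>" for q
    proof (induction q)
      case 0
      show ?case by (simp add: has_contour_integral_0)
    next
      case (pCons a q)
      show ?case
      proof (intro allI)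
        fix i j
        have R: "((\<lambda>z. R z $ i $ j) has_contour_integral (2 * pi * \<i> * mat 1 $ i $ j)) \<gamma>"
        proof -
          have "(\<lambda>z. R z $ i $ j) contour_integrable_on \<gamma>"
            unfolding R_def using \<gamma>
            by (intro contour_integrable_holomorphic_simple[OF holomorphic_on_resolvent])
               (auto simp: finite_imp_closed finite_mat_spectrum open_Compl)
          then show ?thesis
            using contour_integral_resolvent[OF fc] has_contour_integral_integral
            unfolding R_def by metis
        qed
        have "((\<lambda>z. a * R z $ i $ j + (poly q z * mat 1 $ i $ j
              + (\<Sum>k\<in>UNIV. A $ i $ k * (poly q z * R z $ k $ j)))) has_contour_integral
             (a * (2 * pi * \<i> * mat 1 $ i $ j) + (0 + (\<Sum>k\<in>UNIV. A $ i $ k * (2 * pi * \<i> * pmat q A $ k $ j))))) \<gamma>"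
          using pCons.IH
          by (intro has_contour_integral_add has_contour_integral_lmul has_contour_integral_sum R zero
              holomorphic_intros) auto
        then have "((\<lambda>z. poly (pCons a q) z * R z $ i $ j) has_contour_integral
             (a * (2 * pi * \<i> * mat 1 $ i $ j) + (0 + (\<Sum>k\<in>UNIV. A $ i $ k * (2 * pi * \<i> * pmat q A $ k $ j))))) \<gamma>"
        proof (rule has_contour_integral_eq)
          fix z assume z: "z \<in> path_image \<gamma>"
          have "mat z ** R z = mat 1 + A ** R z"
            using inv[OF z] by (simp add: cmat_distribs algebra_simps)
          then have "z * R z $ i $ j = mat 1 $ i $ j + (\<Sum>k\<in>UNIV. A $ i $ k * R z $ k $ j)"
            by (metis mat_mult_component cmat_mult_component vector_add_component)
          then have "poly q z * (z * R z $ i $ j) = poly q z * mat 1 $ i $ j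
              + (\<Sum>k\<in>UNIV. A $ i $ k * (poly q z * R z $ k $ j))"
            by (simp add: distrib_left sum_distrib_left ac_simps)
          then show "a * R z $ i $ j + (poly q z * mat 1 $ i $ j
              + (\<Sum>k\<in>UNIV. A $ i $ k * (poly q z * R z $ k $ j))) = poly (pCons a q) z * R z $ i $ j"
            by (simp add: algebra_simps)
        qed
        moreover have "a * (2 * pi * \<i> * mat 1 $ i $ j) + (0 + (\<Sum>k\<in>UNIV. A $ i $ k * (2 * pi * \<i> * pmat q A $ k $ j)))
            = 2 * pi * \<i> * pmat (pCons a q) A $ i $ j"
          by (simp add: cmat_mult_component mat_component sum_distrib_left algebra_simps)
        ultimately show "((\<lambda>z. poly (pCons a q) z * R z $ i $ j) has_contour_integral
            (2 * pi * \<i> * pmat (pCons a q) A $ i $ j)) \<gamma>" by simp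
      qed
    qed
    have "contour_integral \<gamma> (\<lambda>z. f z * R z $ i $ j) = 2 * pi * \<i> * pmat q A $ i $ j" for i j
    proof (rule contour_integral_unique)
      \<comment> \<open>On the path \<open>p R\<close> agrees with the entire \<open>Q\<close>, so
        the contribution of \<open>p * h\<close> is the integral of \<open>h * Q\<close>, zero by
        Cauchy's theorem on \<open>U\<close>.\<close>
      have "((\<lambda>z. poly q z * R z $ i $ j + h z * Q z $ i $ j) has_contour_integral
          (2 * pi * \<i> * pmat q A $ i $ j + 0)) \<gamma>"
        using polys by (intro has_contour_integral_add zero holomorphic_intros h holomorphic_on_subset[OF Q(1)]) auto
      then show "((\<lambda>z. f z * R z $ i $ j) has_contour_integral (2 * pi * \<i> * pmat q A $ i $ j)) \<gamma>"
        unfolding add_0_right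
      proof (rule has_contour_integral_eq)
        fix z assume z: "z \<in> path_image \<gamma>"
        then have "poly (lin_prod M) z * R z $ i $ j = Q z $ i $ j"
          using Q(2)[of z] \<gamma>(3) by (auto simp: R_def simp flip: mat_mult_component)
        moreover have "f z = poly q z + poly (lin_prod M) z * h z" using f z \<gamma> by auto
        ultimately show "poly q z * R z $ i $ j + h z * Q z $ i $ j = f z * R z $ i $ j"
          by (metis distrib_right mult.assoc mult.commute)
      qed
    qed
    then show ?thesis by (simp add: vec_eq_iff R_def)
  qed
  have "\<exists>q h. h holomorphic_on U \<and> (\<forall>z\<in>U. f z = poly q z + poly (lin_prod M) z * h z)"
    if "f holomorphic_on U" for f
    using hermite_interpolation[OF that assms] by metis
  then show ?thesis using main by (rule that)
qed

section \<open>Contours in the slit plane\<close>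

text \<open>Principal square roots of points of the slit plane lie in the open right half-plane, and
  a finite subset of it fits into a disc that is centred far out on the real axis and stays inside
  the half-plane.\<close>

lemma ex_circle_around_roots:
  assumes "finite S" "S \<subseteq> - \<real>\<^sub>\<le>\<^sub>0"
  obtains R r where "0 < r" "r < R" "\<And>z. z \<in> S \<Longrightarrow> norm (csqrt z - of_real R) < r"
proof -
  define m where "m = Min (insert 1 ((Re \<circ> csqrt) ` S))"
  define B where "B = Max (insert 0 ((\<lambda>z. (norm (csqrt z))\<^sup>2) ` S))"
  have pos: "0 < Re (csqrt z)" if "z \<in> S" for z
  proof (rule ccontr)
    assume "\<not> 0 < Re (csqrt z)"
    then have "Re (csqrt z) = 0" using csqrt_principal[of z] by linarith
    then have "Im ((csqrt z)\<^sup>2) = 0" "Re ((csqrt z)\<^sup>2) \<le> 0"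
      by (simp_all add: power2_eq_square del: power2_csqrt csqrt.sel)
    then have "z \<in> \<real>\<^sub>\<le>\<^sub>0" by (simp add: complex_nonpos_Reals_iff)
    then show False using that assms(2) by auto
  qed
  have m: "m > 0" "m \<le> 1" "\<And>z. z \<in> S \<Longrightarrow> m \<le> Re (csqrt z)"
    unfolding m_def using assms(1) pos by auto
  have B: "B \<ge> 0" "\<And>z. z \<in> S \<Longrightarrow> (norm (csqrt z))\<^sup>2 \<le> B"
    unfolding B_def using assms(1) by auto
  \<comment> \<open>With radius \<open>R - m / 2\<close>, expanding the squares shows that
    \<open>R * m > B\<close> is enough; this choice gives \<open>R * m = B + m\<close>.\<close>
  define R where "R = B / m + 1"
  have Rm: "R * m = B + m" "R \<ge> 1" using m B by (auto simp: R_def field_simps)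
  show ?thesis
  proof (rule that[of "R - m / 2" R])
    show "0 < R - m / 2" "R - m / 2 < R" using m Rm by auto
    fix z assume z: "z \<in> S"
    have "(norm (w - of_real R))\<^sup>2 = (norm w)\<^sup>2 - 2 * R * Re w + R\<^sup>2" for w
      by (simp add: cmod_power2 power2_diff)
    then have "(norm (csqrt z - of_real R))\<^sup>2 = (norm (csqrt z))\<^sup>2 - 2 * R * Re (csqrt z) + R\<^sup>2" .
    also have "\<dots> \<le> B - 2 * R * m + R\<^sup>2"
      using B(2)[OF z] m(3)[OF z] Rm(2) by (auto intro!: add_mono diff_mono mult_left_mono)
    also have "\<dots> < (R - m / 2)\<^sup>2"
    proof -
      have "(R - m / 2)\<^sup>2 = R\<^sup>2 - R * m + (m / 2)\<^sup>2" "0 < (m / 2)\<^sup>2"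
        using m by (simp_all add: power2_diff)
      moreover have "2 * R * m = B + m + R * m" using Rm by simp
      ultimately show ?thesis using m by linarith
    qed
    finally show "norm (csqrt z - of_real R) < R - m / 2"
      by (rule power2_less_imp_less) (use m(2) Rm(2) in linarith)
  qed
qed

text \<open>The contour is the square of a circle in the right half-plane. Unlike an arbitrary valid path it
  is continuously differentiable, which allows exchanging its integral with the Beta integral.\<close>

lemma ex_smooth_fc_contour:
  assumes "mat_spectrum A \<subseteq> - \<real>\<^sub>\<le>\<^sub>0"
  obtains \<gamma> \<gamma>' where "fc_contour (- \<real>\<^sub>\<le>\<^sub>0) A \<gamma>"
    "\<And>u. (\<gamma> has_vector_derivative \<gamma>' u) (at u)" "continuous_on UNIV \<gamma>'"
proof -
  obtain R r where r: "0 < r" "r < R"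
    and root: "\<And>z. z \<in> mat_spectrum A \<Longrightarrow> norm (csqrt z - of_real R) < r"
    using ex_circle_around_roots[OF finite_mat_spectrum assms] by metis
  define c where "c = circlepath (of_real R) r"
  define c' where "c' u = 2 * pi * \<i> * r * exp (2 * of_real pi * \<i> * of_real u)" for u
  define \<gamma> where "\<gamma> = (\<lambda>z. z\<^sup>2) \<circ> c"
  have c': "(c has_vector_derivative c' u) (at u)" for u
    using has_vector_derivative_circlepath[of _ r u UNIV] by (simp add: c_def c'_def)
  have \<gamma>': "(\<gamma> has_vector_derivative 2 * c u * c' u) (at u)" for u
  proof -
    have "((\<lambda>u. c u * c u) has_vector_derivative c u * c' u + c' u * c u) (at u)"
      by (intro has_vector_derivative_mult c')
    then show ?thesis by (simp add: \<gamma>_def o_def power2_eq_square algebra_simps)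
  qed
  have Repos: "Re z > 0" if "z \<in> path_image c" for z
  proof -
    have "norm (of_real R - z) = r" using that r by (simp add: c_def dist_norm)
    then have "\<bar>Re (of_real R - z)\<bar> \<le> r" using abs_Re_le_cmod by metis
    then show ?thesis using r by simp
  qed
  have sq: "z\<^sup>2 \<notin> \<real>\<^sub>\<le>\<^sub>0" if "Re z > 0" for z
  proof
    assume "z\<^sup>2 \<in> \<real>\<^sub>\<le>\<^sub>0"
    then have "Re (z\<^sup>2) \<le> 0" "Im (z\<^sup>2) = 0" by (auto simp: complex_nonpos_Reals_iff)
    then have "Im z = 0" "(Re z)\<^sup>2 \<le> (Im z)\<^sup>2" using that by (simp_all add: Im_power2 Re_power2)
    then show False using that by simp
  qed
  have \<gamma>_path: "valid_path \<gamma>" "pathfinish \<gamma> = pathstart \<gamma>"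
    unfolding \<gamma>_def
    by (rule valid_path_compose_holomorphic[where S = UNIV])
       (auto intro!: holomorphic_intros simp: c_def pathfinish_compose pathstart_compose)
  have image: "path_image \<gamma> = (\<lambda>z. z\<^sup>2) ` path_image c"
    by (simp add: \<gamma>_def path_image_compose)
  have "path_image \<gamma> \<subseteq> - \<real>\<^sub>\<le>\<^sub>0" using Repos sq by (auto simp: image)
  moreover have avoid: "z \<notin> path_image \<gamma>" if "z \<in> mat_spectrum A" for z
  proof
    assume "z \<in> path_image \<gamma>"
    then obtain w where w: "w \<in> path_image c" "z = w\<^sup>2" by (auto simp: image)
    have "csqrt z = w" using Repos[OF w(1)] w(2) by (simp add: csqrt_square)
    then show False using root[OF that] w r by (simp add: c_def dist_norm norm_minus_commute)
  qed
  moreover have "winding_number \<gamma> z = 1" if z: "z \<in> mat_spectrum A" for z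
  proof -
    define w where "w = csqrt z"
    have w: "norm (w - of_real R) < r" "z = w\<^sup>2" using root[OF z] by (simp_all add: w_def)
    have nin: "w \<notin> path_image c" "-w \<notin> path_image c"
      using avoid[OF z] w(2) unfolding image by (auto, metis image_eqI power2_minus)
    have "w \<in> ball (of_real R) r" using w by (simp add: dist_norm norm_minus_commute)
    moreover have "Re w > 0"
    proof -
      have "\<bar>Re (w - of_real R)\<bar> < r" using w(1) abs_Re_le_cmod le_less_trans by blast
      then show ?thesis using r by simp
    qed
    ultimately have n1: "winding_number c w = 1"
      using w by (simp add: c_def winding_number_circlepath)
    have n2: "winding_number c (- w) = 0"
    proof (rule winding_number_zero_outside[where s = "cball (of_real R) r"])
      have "\<not> norm (of_real R + w) \<le> r"
        using complex_Re_le_cmod[of "of_real R + w"] \<open>Re w > 0\<close> r by simp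
      then show "- w \<notin> cball (of_real R) r" by (simp add: dist_norm)
    qed (use r in \<open>auto simp: c_def path_image_circlepath_nonneg\<close>)
    \<comment> \<open>Pulled back along squaring, the winding integrand at \<open>z\<close> becomes
      this sum. The winding number of the squared path is therefore that of the circle at
      \<open>w\<close> plus that at \<open>- w\<close>, namely 1 + 0.\<close>
    have "((\<lambda>v. 1 / (v - w) + 1 / (v - - w)) has_contour_integral
        (2 * pi * \<i> * winding_number c w + 2 * pi * \<i> * winding_number c (- w))) c"
      by (intro has_contour_integral_add has_contour_integral_winding_number nin) (simp_all add: c_def)
    then have int: "contour_integral c (\<lambda>v. 1 / (v - w) + 1 / (v - - w)) = 2 * pi * \<i>"
      using n1 n2 by (simp add: contour_integral_unique)
    have "winding_number \<gamma> z = 1 / (2 * pi * \<i>) * contour_integral \<gamma> (\<lambda>v. 1 / (v - z))"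
      by (rule winding_number_valid_path) (use \<gamma>_path avoid[OF z] in auto)
    also have "contour_integral \<gamma> (\<lambda>v. 1 / (v - z)) = contour_integral c (\<lambda>v. 1 / (v - w) + 1 / (v - - w))"
      unfolding contour_integral_integral
    proof (rule integral_cong)
      fix u :: real assume "u \<in> {0..1}"
      then have "c u \<in> path_image c" by (auto simp: path_image_def)
      then have nz: "c u - w \<noteq> 0" "c u + w \<noteq> 0"
        using nin by (metis eq_iff_diff_eq_0, metis add_eq_0_iff add.commute minus_minus)
      have eq: "\<gamma> u - z = (c u - w) * (c u + w)"
        by (simp add: \<gamma>_def w(2) power2_eq_square algebra_simps)
      have "1 / ((c u - w) * (c u + w)) * (2 * c u * c' u) = (1 / (c u - w) + 1 / (c u - - w)) * c' u"
        using nz by (simp add: divide_simps)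
      then show "1 / (\<gamma> u - z) * vector_derivative \<gamma> (at u) =
          (1 / (c u - w) + 1 / (c u - - w)) * vector_derivative c (at u)"
        by (simp only: eq vector_derivative_at[OF \<gamma>'] vector_derivative_at[OF c'])
    qed
    finally show ?thesis using int by simp
  qed
  moreover have "winding_number \<gamma> z = 0" if "z \<notin> - \<real>\<^sub>\<le>\<^sub>0" for z
  proof (rule simply_connected_imp_winding_number_zero)
    have eq: "- \<real>\<^sub>\<le>\<^sub>0 = - (complex_of_real ` {..0})"
      by (auto simp: nonpos_Reals_def)
    show "simply_connected (- \<real>\<^sub>\<le>\<^sub>0 :: complex set)"
      unfolding eq by (intro starlike_imp_simply_connected starlike_slotted_complex_plane_left)
  qed (use that \<gamma>_path calculation valid_path_imp_path in auto)
  ultimately have "fc_contour (- \<real>\<^sub>\<le>\<^sub>0) A \<gamma>"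
    using \<gamma>_path by (auto simp: fc_contour_def)
  moreover have "continuous_on UNIV (\<lambda>u. 2 * c u * c' u)"
  proof -
    have "continuous_on UNIV c"
      using c' by (meson continuous_at_imp_continuous_on has_vector_derivative_continuous)
    then show ?thesis unfolding c'_def by (intro continuous_intros)
  qed
  ultimately show ?thesis using that[of \<gamma>, OF _ \<gamma>'] by blast
qed

section \<open>The functional calculus on the slit plane and its algebra\<close>

lemma open_slit: "open (- \<real>\<^sub>\<le>\<^sub>0 :: complex set)"
  by (simp add: open_Compl)

abbreviation slit_fc :: "(complex \<Rightarrow> complex) \<Rightarrow> 'n::finite cmat \<Rightarrow> 'n cmat" where
  "slit_fc \<equiv> holo_fc (- \<real>\<^sub>\<le>\<^sub>0)"

text \<open>An admissible contour exists when the spectrum avoids the slit, so the one selected by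
  \<open>SOME\<close> in \<open>holo_fc\<close> is genuine. The last clause retains arbitrary
  contours in order to compare them with the selected one.\<close>

lemma slit_fc_calculus:
  fixes A :: "'n::finite cmat"
  assumes "mat_spectrum A \<subseteq> - \<real>\<^sub>\<le>\<^sub>0"
  obtains p where
    "\<And>f. f holomorphic_on - \<real>\<^sub>\<le>\<^sub>0 \<Longrightarrow>
      \<exists>q h. h holomorphic_on - \<real>\<^sub>\<le>\<^sub>0 \<and> (\<forall>z\<in>- \<real>\<^sub>\<le>\<^sub>0. f z = poly q z + poly p z * h z)"
    "\<And>f q h. h holomorphic_on - \<real>\<^sub>\<le>\<^sub>0 \<Longrightarrow> \<forall>z\<in>- \<real>\<^sub>\<le>\<^sub>0. f z = poly q z + poly p z * h z \<Longrightarrow>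
      slit_fc f A = pmat q A"
    "\<And>f q h \<gamma>. fc_contour (- \<real>\<^sub>\<le>\<^sub>0) A \<gamma> \<Longrightarrow> h holomorphic_on - \<real>\<^sub>\<le>\<^sub>0 \<Longrightarrow>
      \<forall>z\<in>- \<real>\<^sub>\<le>\<^sub>0. f z = poly q z + poly p z * h z \<Longrightarrow>
      (\<chi> i j. contour_integral \<gamma> (\<lambda>z. f z * matrix_inv (mat z - A) $ i $ j) / (2 * pi * \<i>)) = pmat q A"
proof -
  obtain p where p1: "\<And>f. f holomorphic_on - \<real>\<^sub>\<le>\<^sub>0 \<Longrightarrow>
      \<exists>q h. h holomorphic_on - \<real>\<^sub>\<le>\<^sub>0 \<and> (\<forall>z\<in>- \<real>\<^sub>\<le>\<^sub>0. f z = poly q z + poly p z * h z)"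
    and p2: "\<And>f q h \<gamma>. fc_contour (- \<real>\<^sub>\<le>\<^sub>0) A \<gamma> \<Longrightarrow> h holomorphic_on - \<real>\<^sub>\<le>\<^sub>0 \<Longrightarrow>
      \<forall>z\<in>- \<real>\<^sub>\<le>\<^sub>0. f z = poly q z + poly p z * h z \<Longrightarrow>
      (\<chi> i j. contour_integral \<gamma> (\<lambda>z. f z * matrix_inv (mat z - A) $ i $ j) / (2 * pi * \<i>)) = pmat q A"
    by (rule holo_calculus[OF open_slit, of A]) blast
  have "fc_contour (- \<real>\<^sub>\<le>\<^sub>0) A (SOME \<gamma>. fc_contour (- \<real>\<^sub>\<le>\<^sub>0) A \<gamma>)"
    using ex_smooth_fc_contour[OF assms] by (metis someI_ex)
  then have fc: "slit_fc f A = pmat q A"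
    if "h holomorphic_on - \<real>\<^sub>\<le>\<^sub>0" "\<forall>z\<in>- \<real>\<^sub>\<le>\<^sub>0. f z = poly q z + poly p z * h z" for f q h
    unfolding holo_fc_def Let_def by (rule p2[OF _ that])
  show ?thesis
    by (rule that[of p]) (fact p1 fc p2)+
qed

text \<open>Contour independence: the integral over the selected contour and the one over
  \<open>\<gamma>\<close> are both the same \<open>pmat q A\<close>. It permits replacing the
  selected contour by a smooth one.\<close>

lemma slit_fc_eq_integral:
  assumes "mat_spectrum A \<subseteq> - \<real>\<^sub>\<le>\<^sub>0" "f holomorphic_on - \<real>\<^sub>\<le>\<^sub>0" "fc_contour (- \<real>\<^sub>\<le>\<^sub>0) A \<gamma>"
  shows "slit_fc f A = (\<chi> i j. contour_integral \<gamma> (\<lambda>z. f z * matrix_inv (mat z - A) $ i $ j) / (2 * pi * \<i>))"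
proof (rule slit_fc_calculus[OF assms(1)])
  fix p
  assume ex: "\<And>f. f holomorphic_on - \<real>\<^sub>\<le>\<^sub>0 \<Longrightarrow>
      \<exists>q h. h holomorphic_on - \<real>\<^sub>\<le>\<^sub>0 \<and> (\<forall>z\<in>- \<real>\<^sub>\<le>\<^sub>0. f z = poly q z + poly p z * h z)"
    and eq: "\<And>f q h. h holomorphic_on - \<real>\<^sub>\<le>\<^sub>0 \<Longrightarrow> \<forall>z\<in>- \<real>\<^sub>\<le>\<^sub>0. f z = poly q z + poly p z * h z \<Longrightarrow>
      slit_fc f A = pmat q A"
    and eq': "\<And>f q h \<gamma>. fc_contour (- \<real>\<^sub>\<le>\<^sub>0) A \<gamma> \<Longrightarrow> h holomorphic_on - \<real>\<^sub>\<le>\<^sub>0 \<Longrightarrow>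
      \<forall>z\<in>- \<real>\<^sub>\<le>\<^sub>0. f z = poly q z + poly p z * h z \<Longrightarrow>
      (\<chi> i j. contour_integral \<gamma> (\<lambda>z. f z * matrix_inv (mat z - A) $ i $ j) / (2 * pi * \<i>)) = pmat q A"
  obtain q h where qh: "h holomorphic_on - \<real>\<^sub>\<le>\<^sub>0" "\<forall>z\<in>- \<real>\<^sub>\<le>\<^sub>0. f z = poly q z + poly p z * h z"
    using ex[OF assms(2)] by blast
  show ?thesis
    using eq[OF qh] eq'[OF assms(3) qh] by simp
qed

lemma slit_fc_const:
  assumes "mat_spectrum A \<subseteq> - \<real>\<^sub>\<le>\<^sub>0" "\<And>z. z \<notin> \<real>\<^sub>\<le>\<^sub>0 \<Longrightarrow> f z = c"
  shows "slit_fc f A = mat c"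
proof (rule slit_fc_calculus[OF assms(1)])
  fix p
  assume "\<And>f q h. h holomorphic_on - \<real>\<^sub>\<le>\<^sub>0 \<Longrightarrow> \<forall>z\<in>- \<real>\<^sub>\<le>\<^sub>0. f z = poly q z + poly p z * h z \<Longrightarrow>
    slit_fc f A = pmat q A"
  from this[of "\<lambda>_. 0" f "[:c:]"] show ?thesis using assms(2) by simp
qed

lemma slit_fc_ident:
  assumes "mat_spectrum A \<subseteq> - \<real>\<^sub>\<le>\<^sub>0" "\<And>z. z \<notin> \<real>\<^sub>\<le>\<^sub>0 \<Longrightarrow> f z = z"
  shows "slit_fc f A = A"
proof (rule slit_fc_calculus[OF assms(1)])
  fix p
  assume "\<And>f q h. h holomorphic_on - \<real>\<^sub>\<le>\<^sub>0 \<Longrightarrow> \<forall>z\<in>- \<real>\<^sub>\<le>\<^sub>0. f z = poly q z + poly p z * h z \<Longrightarrow>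
    slit_fc f A = pmat q A"
  from this[of "\<lambda>_. 0" f "[:0, 1:]"] show ?thesis using assms(2) by simp
qed

lemma slit_fc_add:
  assumes "mat_spectrum A \<subseteq> - \<real>\<^sub>\<le>\<^sub>0" "f holomorphic_on - \<real>\<^sub>\<le>\<^sub>0" "g holomorphic_on - \<real>\<^sub>\<le>\<^sub>0"
    "\<And>z. z \<notin> \<real>\<^sub>\<le>\<^sub>0 \<Longrightarrow> k z = f z + g z"
  shows "slit_fc k A = slit_fc f A + slit_fc g A"
proof (rule slit_fc_calculus[OF assms(1)])
  fix p
  assume ex: "\<And>f. f holomorphic_on - \<real>\<^sub>\<le>\<^sub>0 \<Longrightarrow>
      \<exists>q h. h holomorphic_on - \<real>\<^sub>\<le>\<^sub>0 \<and> (\<forall>z\<in>- \<real>\<^sub>\<le>\<^sub>0. f z = poly q z + poly p z * h z)"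
    and eq: "\<And>f q h. h holomorphic_on - \<real>\<^sub>\<le>\<^sub>0 \<Longrightarrow> \<forall>z\<in>- \<real>\<^sub>\<le>\<^sub>0. f z = poly q z + poly p z * h z \<Longrightarrow>
    slit_fc f A = pmat q A"
  obtain q1 h1 where 1: "h1 holomorphic_on - \<real>\<^sub>\<le>\<^sub>0" "\<forall>z\<in>- \<real>\<^sub>\<le>\<^sub>0. f z = poly q1 z + poly p z * h1 z"
    using ex[OF assms(2)] by blast
  obtain q2 h2 where 2: "h2 holomorphic_on - \<real>\<^sub>\<le>\<^sub>0" "\<forall>z\<in>- \<real>\<^sub>\<le>\<^sub>0. g z = poly q2 z + poly p z * h2 z"
    using ex[OF assms(3)] by blast
  have "slit_fc k A = pmat (q1 + q2) A"
    by (rule eq[of "\<lambda>z. h1 z + h2 z"])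
       (use 1 2 assms(4) in \<open>auto intro!: holomorphic_intros simp: algebra_simps\<close>)
  then show ?thesis using eq[OF 1] eq[OF 2] by (simp add: pmat_add)
qed

lemma slit_fc_mult:
  assumes "mat_spectrum A \<subseteq> - \<real>\<^sub>\<le>\<^sub>0" "f holomorphic_on - \<real>\<^sub>\<le>\<^sub>0" "g holomorphic_on - \<real>\<^sub>\<le>\<^sub>0"
    "\<And>z. z \<notin> \<real>\<^sub>\<le>\<^sub>0 \<Longrightarrow> k z = f z * g z"
  shows "slit_fc k A = slit_fc f A ** slit_fc g A"
proof (rule slit_fc_calculus[OF assms(1)])
  fix p
  assume ex: "\<And>f. f holomorphic_on - \<real>\<^sub>\<le>\<^sub>0 \<Longrightarrow>
      \<exists>q h. h holomorphic_on - \<real>\<^sub>\<le>\<^sub>0 \<and> (\<forall>z\<in>- \<real>\<^sub>\<le>\<^sub>0. f z = poly q z + poly p z * h z)"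
    and eq: "\<And>f q h. h holomorphic_on - \<real>\<^sub>\<le>\<^sub>0 \<Longrightarrow> \<forall>z\<in>- \<real>\<^sub>\<le>\<^sub>0. f z = poly q z + poly p z * h z \<Longrightarrow>
    slit_fc f A = pmat q A"
  obtain q1 h1 where 1: "h1 holomorphic_on - \<real>\<^sub>\<le>\<^sub>0" "\<forall>z\<in>- \<real>\<^sub>\<le>\<^sub>0. f z = poly q1 z + poly p z * h1 z"
    using ex[OF assms(2)] by blast
  obtain q2 h2 where 2: "h2 holomorphic_on - \<real>\<^sub>\<le>\<^sub>0" "\<forall>z\<in>- \<real>\<^sub>\<le>\<^sub>0. g z = poly q2 z + poly p z * h2 z"
    using ex[OF assms(3)] by blast
  have "slit_fc k A = pmat (q1 * q2) A"
    \<comment> \<open>The cofactor of \<open>p\<close> in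
      \<open>(q1 + p * h1) * (q2 + p * h2) - q1 * q2\<close>.\<close>
    by (rule eq[of "\<lambda>z. poly q1 z * h2 z + h1 z * poly q2 z + poly p z * h1 z * h2 z"])
       (use 1 2 assms(4) in \<open>auto intro!: holomorphic_intros simp: algebra_simps\<close>)
  then show ?thesis using eq[OF 1] eq[OF 2] by (simp add: pmat_mult)
qed

section \<open>The Beta integral of the power function\<close>

text \<open>The weighted harmonic mean of \<open>1\<close> and \<open>z\<close>.\<close>

definition har_kernel :: "real \<Rightarrow> complex \<Rightarrow> complex" where
  "har_kernel s z = z / (of_real (1 - s) * z + of_real s)"

definition beta_weight :: "real \<Rightarrow> real \<Rightarrow> real" where
  "beta_weight t s = s powr (t - 1) * (1 - s) powr (- t)"

text \<open>The slit plane is star-shaped about 1. This keeps the denominators of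
  \<open>har_kernel\<close> away from zero and the segment from 1 to \<open>z\<close> inside the
  domain of the principal power.\<close>

lemma segment_to_1_slit:
  assumes "z \<notin> \<real>\<^sub>\<le>\<^sub>0" "0 \<le> s" "s \<le> 1"
  shows "of_real (1 - s) * z + of_real s \<notin> (\<real>\<^sub>\<le>\<^sub>0 :: complex set)"
proof
  assume "of_real (1 - s) * z + of_real s \<in> (\<real>\<^sub>\<le>\<^sub>0 :: complex set)"
  then have "(1 - s) * Re z + s \<le> 0" "(1 - s) * Im z = 0"
    by (simp_all add: complex_nonpos_Reals_iff)
  moreover have "s \<noteq> 1" using calculation by auto
  ultimately have "Im z = 0" "(1 - s) * Re z \<le> 0" using assms by auto
  then have "Im z = 0" "Re z \<le> 0" using assms \<open>s \<noteq> 1\<close>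
    by (auto simp: mult_le_0_iff)
  then show False using assms by (simp add: complex_nonpos_Reals_iff)
qed

lemma segment_to_1_nonzero:
  assumes "z \<notin> \<real>\<^sub>\<le>\<^sub>0" "0 \<le> s" "s \<le> 1"
  shows "of_real (1 - s) * z + of_real s \<noteq> (0 :: complex)"
  using segment_to_1_slit[OF assms] by auto

lemma holomorphic_har_kernel:
  "0 \<le> s \<Longrightarrow> s \<le> 1 \<Longrightarrow> har_kernel s holomorphic_on - \<real>\<^sub>\<le>\<^sub>0"
  unfolding har_kernel_def using segment_to_1_nonzero
  by (intro holomorphic_intros) auto

lemma beta_weight_nonneg: "0 \<le> s \<Longrightarrow> s \<le> 1 \<Longrightarrow> 0 \<le> beta_weight t s"
  by (simp add: beta_weight_def)

lemma continuous_on_beta_weight: "0 < a \<Longrightarrow> b < 1 \<Longrightarrow> continuous_on {a..b} (beta_weight t)"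
  unfolding beta_weight_def by (intro continuous_intros) auto

text \<open>Up to the factor \<open>- z powr (- t)\<close>, the right-hand side is the derivative
  with respect to \<open>z\<close> of \<open>beta_weight t s * z powr (1 - t) / D\<close>. That it
  is also a total derivative in \<open>s\<close>, of a function whose numerator tends to zero at
  both endpoints for \<open>0 < t < 1\<close>, is what makes the Beta representation true.\<close>

lemma beta_kernel_antiderivative:
  fixes z :: complex
  assumes s: "0 < s" "s < 1" and z: "z \<notin> \<real>\<^sub>\<le>\<^sub>0"
  defines "D \<equiv> of_real (1 - s) * z + of_real s"
  shows "((\<lambda>s. of_real (s powr t * (1 - s) powr (1 - t)) / (of_real (1 - s) * z + of_real s))
    has_vector_derivative (of_real (beta_weight t s) * (of_real t / D - of_real s / D\<^sup>2))) (at s within X)"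
proof -
  have D: "D \<noteq> 0" unfolding D_def by (rule segment_to_1_nonzero) (use s z in auto)
  define x where "x = s powr (t - 1)"
  define y where "y = (1 - s) powr (- t)"
  have p: "s powr t = s * x" "(1 - s) powr (1 - t) = (1 - s) * y"
    using s by (simp_all add: x_def y_def powr_mult_base)
  have "((\<lambda>s. s powr t * (1 - s) powr (1 - t)) has_real_derivative
      (t * x * (1 - s) powr (1 - t) - s powr t * ((1 - t) * y))) (at s within X)"
    using s by (auto intro!: derivative_eq_intros simp: x_def y_def)
  moreover have "t * x * (1 - s) powr (1 - t) - s powr t * ((1 - t) * y) = x * y * (t - s)"
    unfolding p by (simp add: algebra_simps)
  ultimately have "((\<lambda>s. s powr t * (1 - s) powr (1 - t)) has_vector_derivative (x * y * (t - s))) (at s within X)"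
    by (simp add: has_real_derivative_iff_has_vector_derivative)
  then have num: "((\<lambda>s. complex_of_real (s powr t * (1 - s) powr (1 - t))) has_vector_derivative of_real (x * y * (t - s))) (at s within X)"
    by (rule bounded_linear.has_vector_derivative[OF bounded_linear_of_real])
  have den: "((\<lambda>s. of_real (1 - s) * z + of_real s) has_vector_derivative (1 - z)) (at s within X)"
    by (auto intro!: derivative_eq_intros simp: scaleR_conv_of_real)
  have inv: "((\<lambda>s. inverse (of_real (1 - s) * z + of_real s)) has_vector_derivative ((1 - z) * - inverse (D\<^sup>2))) (at s within X)"
  proof -
    have "(inverse has_field_derivative - inverse (D ^ 2)) (at D)"
      using DERIV_inverse[OF D, of UNIV] by (simp add: numeral_2_eq_2)
    then have "((inverse \<circ> (\<lambda>s. of_real (1 - s) * z + of_real s)) has_vector_derivative (1 - z) * (- inverse (D ^ 2))) (at s within X)"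
      unfolding D_def
      by (intro field_vector_diff_chain_within[OF den]) (auto intro: has_field_derivative_at_within)
    then show ?thesis by (simp only: o_def)
  qed
  have "((\<lambda>s. of_real (s powr t * (1 - s) powr (1 - t)) * inverse (of_real (1 - s) * z + of_real s))
      has_vector_derivative (of_real (s powr t * (1 - s) powr (1 - t)) * ((1 - z) * - inverse (D\<^sup>2)) + of_real (x * y * (t - s)) * inverse D))
      (at s within X)"
    using has_vector_derivative_mult[OF num inv] by (simp add: D_def)
  moreover have "of_real (s powr t * (1 - s) powr (1 - t)) * ((1 - z) * - inverse (D\<^sup>2)) + of_real (x * y * (t - s)) * inverse D
      = of_real (beta_weight t s) * (of_real t / D - of_real s / D\<^sup>2)"
  proof -
    have 1: "of_real t / D - of_real s / D\<^sup>2 = (of_real t * D - of_real s) / D\<^sup>2"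
      using D by (simp add: field_simps power2_eq_square)
    have 2: "of_real (s * x * ((1 - s) * y)) * ((1 - z) * - inverse (D\<^sup>2)) + of_real (x * y * (t - s)) * inverse D
      = of_real (x * y) * ((of_real (t - s) * D - of_real (s * (1 - s)) * (1 - z)) / D\<^sup>2)"
      using D by (simp add: field_simps power2_eq_square)
    have 3: "of_real (t - s) * D - of_real (s * (1 - s)) * (1 - z) = of_real t * D - of_real s"
      unfolding D_def by (simp add: algebra_simps)
    show ?thesis unfolding p 1 2 3 beta_weight_def x_def[symmetric] y_def[symmetric] by simp
  qed
  ultimately show ?thesis by (simp add: divide_inverse)
qed

text \<open>Differentiating \<open>z powr (1 - t) * \<integral> beta_weight t s / ((1 - s) z + s) ds\<close> along the segment from
  \<open>1\<close> to \<open>z\<close> gives a total derivative in \<open>s\<close>, hence only the boundary terms at \<open>a\<close> and \<open>b\<close>.\<close>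

lemma powr_approx:
  assumes t: "0 < t" "t < 1" and ab: "0 < a" "a \<le> b" "b < 1" and z: "z \<notin> \<real>\<^sub>\<le>\<^sub>0"
    and \<delta>: "\<delta> > 0" "\<And>r. r \<in> {0..1} \<Longrightarrow> \<delta> \<le> norm (1 + of_real r * (z - 1))"
    and B: "\<And>r. r \<in> {0..1} \<Longrightarrow> norm ((1 + of_real r * (z - 1)) powr - of_real t) \<le> B"
  defines "e \<equiv> \<lambda>s. s powr t * (1 - s) powr (1 - t)"
  shows "norm (z powr - of_real t * integral {a..b} (\<lambda>s. of_real (beta_weight t s) * har_kernel s z)
      - of_real (integral {a..b} (beta_weight t))) \<le> norm (z - 1) * B * (e a + e b) / \<delta>"
proof -
  define \<zeta> where "\<zeta> r = 1 + of_real r * (z - 1)" for r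
  define D where "D r s = of_real (1 - s) * \<zeta> r + of_real s" for r s
  have \<zeta>: "\<zeta> r \<notin> \<real>\<^sub>\<le>\<^sub>0" "\<zeta> r \<noteq> 0" if "r \<in> {0..1}" for r
  proof -
    have "of_real (1 - (1 - r)) * z + of_real (1 - r) \<notin> (\<real>\<^sub>\<le>\<^sub>0 :: complex set)"
      using that z by (intro segment_to_1_slit) auto
    then show "\<zeta> r \<notin> \<real>\<^sub>\<le>\<^sub>0" by (simp add: \<zeta>_def algebra_simps)
    then show "\<zeta> r \<noteq> 0" by auto
  qed
  have D: "D r s \<noteq> 0" if "r \<in> {0..1}" "s \<in> {a..b}" for r s
    unfolding D_def using that ab by (intro segment_to_1_nonzero \<zeta>) auto
  have D_\<delta>: "\<delta> \<le> norm (D r s)" if "r \<in> {0..1}" "s \<in> {a..b}" for r s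
  proof -
    have "D r s = 1 + of_real ((1 - s) * r) * (z - 1)" by (simp add: D_def \<zeta>_def algebra_simps)
    moreover have "(1 - s) * r \<in> {0..1}" using that ab by (auto intro: mult_le_one)
    ultimately show ?thesis using \<delta>(2) by metis
  qed
  define w where "w r s = of_real (beta_weight t s) * (\<zeta> r powr (1 - of_real t) / D r s)" for r s
  define w' where "w' r s = - (z - 1) * \<zeta> r powr (- of_real t) *
      (of_real (beta_weight t s) * (of_real t / D r s - of_real s / (D r s)\<^sup>2))" for r s
  have deriv: "((\<lambda>r. w r s) has_vector_derivative w' r s) (at r within {0..1})"
    if r: "r \<in> {0..1}" and s: "s \<in> cbox a b" for r s
  proof -
    have Dn: "D r s \<noteq> 0" using D r s by simp
    let ?g = "\<lambda>\<zeta>. of_real (beta_weight t s) * (\<zeta> powr (1 - of_real t) / (of_real (1 - s) * \<zeta> + of_real s))"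
    have g: "(?g has_field_derivative of_real (beta_weight t s) *
        (((1 - of_real t) * \<zeta> r powr (1 - of_real t - 1) * D r s - \<zeta> r powr (1 - of_real t) * of_real (1 - s)) / (D r s * D r s))) (at (\<zeta> r) within \<zeta> ` {0..1})"
      using \<zeta>[OF r] Dn unfolding D_def
      by (intro DERIV_cmult) (auto intro!: derivative_eq_intros)
    have \<zeta>': "(\<zeta> has_vector_derivative (z - 1)) (at r within {0..1})"
      unfolding \<zeta>_def by (auto intro!: derivative_eq_intros simp: scaleR_conv_of_real)
    have "((?g \<circ> \<zeta>) has_vector_derivative (z - 1) * (of_real (beta_weight t s) *
        (((1 - of_real t) * \<zeta> r powr (1 - of_real t - 1) * D r s - \<zeta> r powr (1 - of_real t) * of_real (1 - s)) / (D r s * D r s))))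
        (at r within {0..1})"
      by (rule field_vector_diff_chain_within[OF \<zeta>' g])
    moreover have N: "(1 - of_real t) * \<zeta> r powr (1 - of_real t - 1) * D r s - \<zeta> r powr (1 - of_real t) * of_real (1 - s)
      = - (\<zeta> r powr - of_real t * (of_real t * D r s - of_real s))"
    proof -
      have "\<zeta> r powr (1 - of_real t) = \<zeta> r * \<zeta> r powr (- of_real t)"
        using \<zeta>[OF r] by (simp add: powr_diff powr_minus divide_inverse)
      then show ?thesis by (simp add: D_def algebra_simps)
    qed
    moreover have "w' r s = (z - 1) * (of_real (beta_weight t s) *
        (- (\<zeta> r powr - of_real t * (of_real t * D r s - of_real s)) / (D r s * D r s)))"
    proof -
      have "of_real t / D r s - of_real s / (D r s)\<^sup>2 = (of_real t * D r s - of_real s) / (D r s * D r s)"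
        using Dn by (simp add: field_simps power2_eq_square)
      moreover have "- u * P * (W * (X / Y)) = u * (W * (- (P * X) / Y))" for u P W X Y :: complex
        by (simp add: ac_simps)
      ultimately show ?thesis unfolding w'_def by (simp only:)
    qed
    ultimately show ?thesis by (simp only: w_def D_def o_def)
  qed
  have cont_\<zeta>: "continuous_on X \<zeta>" for X unfolding \<zeta>_def by (intro continuous_intros)
  have cont_w: "continuous_on {a..b} (w r)" if "r \<in> {0..1}" for r
    unfolding w_def using D[OF that] ab unfolding D_def
    by (intro continuous_intros continuous_on_beta_weight) auto
  have cont_w': "continuous_on ({0..1} \<times> cbox a b) (\<lambda>(r, s). w' r s)"
  proof -
    have 1: "continuous_on ({0..1} \<times> cbox a b) (\<lambda>x. \<zeta> (fst x))"
      by (intro continuous_on_compose2[OF cont_\<zeta>] continuous_intros) auto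
    have 2: "continuous_on ({0..1} \<times> cbox a b) (\<lambda>x. beta_weight t (snd x))"
      using ab by (intro continuous_on_compose2[OF continuous_on_beta_weight] continuous_intros) auto
    have "continuous_on {0..1} (\<lambda>r. \<zeta> r powr (- of_real t))"
    proof (intro continuous_on_powr_complex cont_\<zeta> continuous_intros)
      show "{0..1} \<subseteq> {r. 0 \<le> Re (\<zeta> r) \<or> Im (\<zeta> r) \<noteq> 0}"
        using \<zeta>(1) by (force simp: complex_nonpos_Reals_iff)
    qed (use \<zeta>(2) in auto)
    then have 3: "continuous_on ({0..1} \<times> cbox a b) (\<lambda>x. \<zeta> (fst x) powr (- of_real t))"
      by (rule continuous_on_compose2) (auto intro!: continuous_intros)
    have 4: "continuous_on ({0..1} \<times> cbox a b) (\<lambda>x. D (fst x) (snd x))"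
      unfolding D_def by (intro continuous_intros 1)
    have 5: "D (fst x) (snd x) \<noteq> 0" if "x \<in> {0..1} \<times> cbox a b" for x
      using that by (intro D) auto
    show ?thesis
      unfolding w'_def case_prod_beta
      by (intro continuous_on_mult continuous_on_diff continuous_on_divide continuous_on_power
          continuous_on_const continuous_on_of_real continuous_on_snd continuous_on_id 2 3 4)
         (use 5 in auto)
  qed
  define \<phi> where "\<phi> r = integral (cbox a b) (w r)" for r
  have \<phi>': "(\<phi> has_vector_derivative integral (cbox a b) (w' r)) (at r within {0..1})" if "r \<in> {0..1}" for r
    unfolding \<phi>_def
    by (rule leibniz_rule_vector_derivative[OF deriv _ cont_w' that])
       (auto intro!: integrable_continuous_interval cont_w)
  have int_w': "integral (cbox a b) (w' r) = - (z - 1) * \<zeta> r powr (- of_real t) *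
      (of_real (e b) / D r b - of_real (e a) / D r a)" if "r \<in> {0..1}" for r
  proof -
    have "((\<lambda>s. of_real (beta_weight t s) * (of_real t / D r s - of_real s / (D r s)\<^sup>2)) has_integral
       (of_real (e b) / D r b - of_real (e a) / D r a)) {a..b}"
      unfolding D_def e_def
      by (rule fundamental_theorem_of_calculus[OF ab(2)], rule beta_kernel_antiderivative)
         (use ab \<zeta>[OF that] in auto)
    note I = integral_unique[OF has_integral_mult_right[OF this, of "- (z - 1) * \<zeta> r powr (- of_real t)"]]
    have "w' r = (\<lambda>s. - (z - 1) * \<zeta> r powr (- of_real t) *
        (of_real (beta_weight t s) * (of_real t / D r s - of_real s / (D r s)\<^sup>2)))"
      by (rule ext) (rule w'_def)
    then show ?thesis using I by (simp only: cbox_interval)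
  qed
  have e: "e a \<ge> 0" "e b \<ge> 0" by (simp_all add: e_def)
  \<comment> \<open>Mean value inequality along the segment: at \<open>\<zeta> 0 = 1\<close> the
    denominator is 1 and \<open>\<phi>\<close> is the plain mass of the weight, at
    \<open>\<zeta> 1 = z\<close> it is the rescaled kernel integral.\<close>
  have "norm (\<phi> 1 - \<phi> 0) \<le> norm (z - 1) * B * (e a + e b) / \<delta> * norm (1 - 0 :: real)"
  proof (rule differentiable_bound[where S = "{0..1}" and f' = "\<lambda>r h. h *\<^sub>R integral (cbox a b) (w' r)"])
    fix r :: real assume r: "r \<in> {0..1}"
    show "(\<phi> has_derivative (\<lambda>h. h *\<^sub>R integral (cbox a b) (w' r))) (at r within {0..1})"
      using \<phi>'[OF r] by (simp add: has_vector_derivative_def)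
    have "norm (of_real (e b) / D r b - of_real (e a) / D r a) \<le> e b / norm (D r b) + e a / norm (D r a)"
      using e by (intro order.trans[OF norm_triangle_ineq4]) (simp add: norm_divide)
    also have "\<dots> \<le> e b / \<delta> + e a / \<delta>"
      using e D_\<delta>[OF r] D[OF r] \<delta>(1) ab by (intro add_mono divide_left_mono mult_pos_pos) (auto intro: less_le_trans)
    finally have *: "norm (of_real (e b) / D r b - of_real (e a) / D r a) \<le> (e a + e b) / \<delta>"
      by (simp add: add_divide_distrib)
    define M where "M = norm (z - 1) * B * (e a + e b) / \<delta>"
    have M: "norm (integral (cbox a b) (w' r)) \<le> M"
      unfolding int_w'[OF r] M_def norm_mult norm_minus_cancel times_divide_eq_right [symmetric]
    proof (intro mult_mono order.refl *)
      show "norm (\<zeta> r powr - of_real t) \<le> B" using B[OF r] by (simp add: \<zeta>_def)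
      then have "0 \<le> B" by (rule order.trans[OF norm_ge_zero])
      then show "0 \<le> norm (z - 1) * B" by simp
    qed auto
    show "onorm (\<lambda>h. h *\<^sub>R integral (cbox a b) (w' r)) \<le> norm (z - 1) * B * (e a + e b) / \<delta>"
      unfolding M_def [symmetric]
    proof (rule onorm_bound)
      show "0 \<le> M" using M by (rule order.trans[OF norm_ge_zero])
      show "norm (h *\<^sub>R integral (cbox a b) (w' r)) \<le> M * norm h" for h
        using mult_right_mono[OF M, of "norm h"] by (simp add: mult.commute)
    qed
  qed auto
  moreover have "\<phi> 1 = z powr - of_real t * integral {a..b} (\<lambda>s. of_real (beta_weight t s) * har_kernel s z)"
  proof -
    have "z \<noteq> 0" using z by auto
    then have "z powr (1 - of_real t) = z powr (- of_real t) * z"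
      by (simp add: powr_diff powr_minus divide_inverse)
    then have "w 1 = (\<lambda>s. z powr - of_real t * (of_real (beta_weight t s) * har_kernel s z))"
      by (auto simp: w_def D_def \<zeta>_def har_kernel_def)
    then show ?thesis by (simp add: \<phi>_def)
  qed
  moreover have "\<phi> 0 = of_real (integral {a..b} (beta_weight t))"
  proof -
    have "w 0 = (\<lambda>s. of_real (beta_weight t s))" by (auto simp: w_def D_def \<zeta>_def)
    then show ?thesis
      using integral_linear[OF integrable_continuous_interval[OF continuous_on_beta_weight[of a b t]] bounded_linear_of_real] ab
      by (simp add: \<phi>_def o_def)
  qed
  ultimately show ?thesis by simp
qed


text \<open>The weight is singular at both endpoints, so the integral is truncated; dividing by the mass of
  the truncated weight makes the value of the Beta function irrelevant.\<close>

definition cutoff :: "nat \<Rightarrow> real" where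
  "cutoff n = 1 / real (n + 3)"

text \<open>The shift by 3 keeps each cutoff at most 1/3, so the truncated intervals are
  nondegenerate and all contain the one for \<open>n = 0\<close>, whose mass serves as a uniform
  lower bound.\<close>

lemma cutoff: "0 < cutoff n" "cutoff n < 1 - cutoff n" "cutoff n < 1" "1 - cutoff n < 1" "cutoff n \<le> cutoff 0"
  by (simp_all add: cutoff_def field_simps)

definition beta_mass :: "real \<Rightarrow> nat \<Rightarrow> real" where
  "beta_mass t n = integral {cutoff n..1 - cutoff n} (beta_weight t)"

lemma beta_mass_ge: "beta_mass t 0 \<le> beta_mass t n"
  unfolding beta_mass_def using cutoff[of n] cutoff[of 0]
  by (intro integral_subset_le)
     (auto intro!: integrable_continuous_interval continuous_on_beta_weight beta_weight_nonneg)

lemma beta_mass_pos: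
  assumes "0 < t" "t < 1"
  shows "0 < beta_mass t n"
proof -
  have "integral {cutoff n..1 - cutoff n} (\<lambda>_. 1) \<le> integral {cutoff n..1 - cutoff n} (beta_weight t)"
  proof (rule integral_le)
    show "beta_weight t integrable_on {cutoff n..1 - cutoff n}"
      using cutoff[of n] by (intro integrable_continuous_interval continuous_on_beta_weight)
    fix s assume "s \<in> {cutoff n..1 - cutoff n}"
    then have s: "0 < s" "s < 1" using cutoff[of n] by auto
    have "1 \<le> s powr (t - 1)" "1 \<le> (1 - s) powr (- t)"
      using powr_mono2'[of "t - 1" s 1] powr_mono2'[of "- t" "1 - s" 1] s assms by auto
    then show "1 \<le> beta_weight t s"
      unfolding beta_weight_def by (metis mult_mono' mult_1 zero_le_one)
  qed auto
  then show ?thesis using cutoff(2)[of n] by (simp add: beta_mass_def)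
qed

text \<open>The boundary terms in \<open>powr_approx\<close> tend to zero because \<open>t\<close>
  and \<open>1 - t\<close> are positive. Uniformity on compact sets is what allows the limit to be
  taken under a contour integral.\<close>

lemma uniform_limit_powr:
  assumes t: "0 < t" "t < 1" and K: "compact K" "K \<subseteq> - \<real>\<^sub>\<le>\<^sub>0"
  shows "uniform_limit K
    (\<lambda>n z. integral {cutoff n..1 - cutoff n} (\<lambda>s. of_real (beta_weight t s) * har_kernel s z) / of_real (beta_mass t n))
    (\<lambda>z. z powr of_real t) sequentially"
proof -
  \<comment> \<open>The union of the segments from 1 to the points of \<open>K\<close>. It is
    compact and avoids the slit, so the constants \<open>\<delta>\<close> and \<open>B\<close> of
    \<open>powr_approx\<close> can be chosen for all \<open>z\<close> in \<open>K\<close> at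
    once.\<close>
  define K' where "K' = (\<lambda>(z, r). 1 + of_real r * (z - 1)) ` (K \<times> {0..1 :: real})"
  have "compact K'"
    unfolding K'_def case_prod_beta
    by (intro compact_continuous_image compact_Times continuous_intros K) auto
  have K'_slit: "K' \<subseteq> - \<real>\<^sub>\<le>\<^sub>0"
  proof
    fix y assume "y \<in> K'"
    then obtain z r where zr: "z \<in> K" "0 \<le> r" "r \<le> 1" "y = 1 + of_real r * (z - 1)"
      by (auto simp: K'_def)
    have "of_real (1 - (1 - r)) * z + of_real (1 - r) \<notin> (\<real>\<^sub>\<le>\<^sub>0 :: complex set)"
      using zr K by (intro segment_to_1_slit) auto
    then show "y \<in> - \<real>\<^sub>\<le>\<^sub>0"
      by (simp add: zr(4) algebra_simps)
  qed
  have K'I: "1 + of_real r * (z - 1) \<in> K'" if "z \<in> K" "r \<in> {0..1}" for z r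
    using that by (force simp: K'_def)
  obtain \<delta> where \<delta>: "\<delta> > 0" "\<And>y. y \<in> K' \<Longrightarrow> \<delta> \<le> norm y"
  proof -
    have "0 \<notin> K'" using K'_slit by auto
    then obtain d where "d > 0" "\<forall>y\<in>K'. d \<le> dist 0 y"
      using separate_point_closed[OF compact_imp_closed[OF \<open>compact K'\<close>]] by metis
    then show ?thesis using that by auto
  qed
  have powr_cont: "continuous_on Y (\<lambda>z. z powr c)" if "Y \<subseteq> - \<real>\<^sub>\<le>\<^sub>0" for Y and c :: complex
    using that by (intro continuous_on_powr_complex continuous_intros) (force simp: complex_nonpos_Reals_iff)+
  have "bounded ((\<lambda>z. z powr - of_real t) ` K')"
    by (intro compact_imp_bounded compact_continuous_image powr_cont \<open>compact K'\<close> K'_slit)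
  then obtain B where B: "\<And>y. y \<in> K' \<Longrightarrow> norm (y powr - of_real t) \<le> B"
    by (auto simp: bounded_iff)
  have "bounded ((\<lambda>z. z powr of_real t * (z - 1)) ` K)"
    by (intro compact_imp_bounded compact_continuous_image continuous_intros powr_cont K)
  then obtain C where C: "\<And>z. z \<in> K \<Longrightarrow> norm (z powr of_real t * (z - 1)) \<le> C"
    by (auto simp: bounded_iff)
  define e where "e s = s powr t * (1 - s) powr (1 - t)" for s
  define err where "err n = (max C 0 * max B 0 / \<delta> / beta_mass t 0) * (e (cutoff n) + e (1 - cutoff n))" for n
  have e0: "e s \<ge> 0" for s by (simp add: e_def)
  have cutoff_0: "cutoff \<longlonglongrightarrow> 0"
    unfolding cutoff_def by real_asymp
  have "(\<lambda>n. e (cutoff n)) \<longlonglongrightarrow> 0 powr t * (1 - 0) powr (1 - t)"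
    unfolding e_def using t cutoff
    by (intro tendsto_intros tendsto_powr' cutoff_0) (auto intro!: always_eventually less_imp_le)
  moreover have "(\<lambda>n. e (1 - cutoff n)) \<longlonglongrightarrow> (1 - 0) powr t * (1 - (1 - 0)) powr (1 - t)"
    unfolding e_def using t cutoff
    by (intro tendsto_intros tendsto_powr' cutoff_0) (auto intro!: always_eventually less_imp_le)
  ultimately have "(\<lambda>n. e (cutoff n) + e (1 - cutoff n)) \<longlonglongrightarrow> 0 + 0"
    using t by (intro tendsto_add) auto
  then have "err \<longlonglongrightarrow> (max C 0 * max B 0 / \<delta> / beta_mass t 0) * 0"
    unfolding err_def by (intro tendsto_mult tendsto_const) simp
  then have err: "err \<longlonglongrightarrow> 0" by simp
  have bound: "norm (integral {cutoff n..1 - cutoff n} (\<lambda>s. of_real (beta_weight t s) * har_kernel s z) / of_real (beta_mass t n)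
      - z powr of_real t) \<le> err n" if z: "z \<in> K" for n z
  proof -
    define I where "I = integral {cutoff n..1 - cutoff n} (\<lambda>s. of_real (beta_weight t s) * har_kernel s z)"
    define c where "c = beta_mass t n"
    have c: "c > 0" "beta_mass t 0 \<le> c" using beta_mass_pos[OF t] beta_mass_ge by (auto simp: c_def)
    have zs: "z \<notin> \<real>\<^sub>\<le>\<^sub>0" "z \<noteq> 0" using z K by auto
    have "norm (z powr - of_real t * I - of_real c) \<le> norm (z - 1) * max B 0 * (e (cutoff n) + e (1 - cutoff n)) / \<delta>"
      unfolding I_def c_def beta_mass_def e_def
    proof (rule powr_approx[OF t _ _ _ zs(1) \<delta>(1)])
      fix r :: real assume "r \<in> {0..1}"
      note r = K'I[OF z this]
      show "\<delta> \<le> norm (1 + of_real r * (z - 1))" by (rule \<delta>(2)[OF r])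
      show "norm ((1 + of_real r * (z - 1)) powr - of_real t) \<le> max B 0"
        using B[OF r] by simp
    qed (use cutoff[of n] in auto)
    moreover have "I / of_real c - z powr of_real t
        = z powr of_real t * (z powr - of_real t * I - of_real c) / of_real c"
    proof -
      have "z powr of_real t * z powr - of_real t = 1"
        using zs by (simp add: powr_minus)
      then have "z powr of_real t * (z powr - of_real t * I - of_real c) = I - z powr of_real t * of_real c"
        by (metis mult.assoc mult_1 right_diff_distrib)
      then show ?thesis using c by (simp add: field_simps)
    qed
    moreover have "norm (I / of_real c - z powr of_real t)
        = norm (z powr of_real t) * norm (z powr - of_real t * I - of_real c) / c"
      unfolding calculation(2) using c by (simp add: norm_divide norm_mult)
    ultimately have "norm (I / of_real c - z powr of_real t)
        \<le> norm (z powr of_real t) * (norm (z - 1) * max B 0 * (e (cutoff n) + e (1 - cutoff n)) / \<delta>) / c"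
      using c by (simp only:) (intro divide_right_mono mult_left_mono, auto)
    also have "\<dots> = norm (z powr of_real t * (z - 1)) * (max B 0 * (e (cutoff n) + e (1 - cutoff n)) / \<delta>) / c"
      by (simp add: norm_mult)
    also have "\<dots> \<le> max C 0 * (max B 0 * (e (cutoff n) + e (1 - cutoff n)) / \<delta>) / c"
      using C[OF z] c e0 \<delta>(1) by (intro divide_right_mono mult_right_mono) auto
    also have "\<dots> \<le> max C 0 * (max B 0 * (e (cutoff n) + e (1 - cutoff n)) / \<delta>) / beta_mass t 0"
      using c e0 \<delta>(1) beta_mass_pos[OF t, of 0] by (intro divide_left_mono) auto
    also have "\<dots> = err n" by (simp add: err_def)
    finally show ?thesis by (simp add: I_def c_def)
  qed
  show ?thesis
  proof (rule uniform_limitI)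
    fix d :: real assume "d > 0"
    with err have "\<forall>\<^sub>F n in sequentially. err n < d" by (rule order_tendstoD)
    then show "\<forall>\<^sub>F n in sequentially. \<forall>z\<in>K. dist
        (integral {cutoff n..1 - cutoff n} (\<lambda>s. of_real (beta_weight t s) * har_kernel s z) / of_real (beta_mass t n))
        (z powr of_real t) < d"
      by eventually_elim (use bound in \<open>fastforce simp: dist_norm intro: le_less_trans\<close>)
  qed
qed


text \<open>All dependence on \<open>A\<close> and on the derivative of the path is collected in one
  continuous kernel \<open>\<kappa>\<close> that is the same for every \<open>f\<close>. Exchanging
  integrals and passing to limits then take place on a compact interval with continuous
  integrands.\<close>

lemma slit_fc_entry_integral:
  assumes "mat_spectrum A \<subseteq> - \<real>\<^sub>\<le>\<^sub>0"
  obtains \<gamma> \<kappa> :: "real \<Rightarrow> complex" where "continuous_on {0..1} \<gamma>" "\<gamma> ` {0..1} \<subseteq> - \<real>\<^sub>\<le>\<^sub>0" "continuous_on {0..1} \<kappa>"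
    "\<And>f. f holomorphic_on - \<real>\<^sub>\<le>\<^sub>0 \<Longrightarrow> slit_fc f A $ i $ j = integral {0..1} (\<lambda>u. f (\<gamma> u) * \<kappa> u)"
proof -
  obtain \<gamma> \<gamma>' where fc: "fc_contour (- \<real>\<^sub>\<le>\<^sub>0) A \<gamma>"
    and deriv: "\<And>u. (\<gamma> has_vector_derivative \<gamma>' u) (at u)" and cont': "continuous_on UNIV \<gamma>'"
    using ex_smooth_fc_contour[OF assms] by metis
  define \<kappa> where "\<kappa> u = matrix_inv (mat (\<gamma> u) - A) $ i $ j * \<gamma>' u / (2 * pi * \<i>)" for u
  have cont: "continuous_on {0..1} \<gamma>"
    using fc by (auto simp: fc_contour_def path_def dest!: valid_path_imp_path)
  have image: "\<gamma> ` {0..1} \<subseteq> - \<real>\<^sub>\<le>\<^sub>0" "\<gamma> ` {0..1} \<subseteq> - mat_spectrum A"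
    using fc by (auto simp: fc_contour_def path_image_def)
  have "continuous_on {0..1} (\<lambda>u. matrix_inv (mat (\<gamma> u) - A) $ i $ j)"
    by (rule continuous_on_compose2[OF holomorphic_on_imp_continuous_on[OF holomorphic_on_resolvent] cont image(2)])
  then have "continuous_on {0..1} \<kappa>"
    unfolding \<kappa>_def
    by (intro continuous_on_mult continuous_on_divide continuous_on_const continuous_on_subset[OF cont']) auto
  moreover have "slit_fc f A $ i $ j = integral {0..1} (\<lambda>u. f (\<gamma> u) * \<kappa> u)"
    if "f holomorphic_on - \<real>\<^sub>\<le>\<^sub>0" for f
  proof -
    have "slit_fc f A $ i $ j = integral {0..1} (\<lambda>u. f (\<gamma> u) * matrix_inv (mat (\<gamma> u) - A) $ i $ j * \<gamma>' u) / (2 * pi * \<i>)"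
      by (simp add: slit_fc_eq_integral[OF assms that fc] contour_integral_integral vector_derivative_at[OF deriv])
    also have "\<dots> = integral {0..1} (\<lambda>u. f (\<gamma> u) * matrix_inv (mat (\<gamma> u) - A) $ i $ j * \<gamma>' u / (2 * pi * \<i>))"
      by (rule integral_divide [symmetric])
    finally show ?thesis by (simp add: \<kappa>_def mult.assoc)
  qed
  ultimately show ?thesis using that cont image(1) by blast
qed

lemma continuous_on_har_kernel_path:
  fixes \<gamma> :: "real \<Rightarrow> complex"
  assumes "continuous_on {0..1} \<gamma>" "\<gamma> ` {0..1} \<subseteq> - \<real>\<^sub>\<le>\<^sub>0"
  shows "continuous_on ({0..1} \<times> {0..1}) (\<lambda>x. har_kernel (fst x) (\<gamma> (snd x)))"
proof -
  have 1: "continuous_on ({0..1} \<times> {0..1}) (\<lambda>x. \<gamma> (snd x :: real))"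
    by (rule continuous_on_compose2[OF assms(1)]) (auto intro!: continuous_intros)
  have "of_real (1 - fst x) * \<gamma> (snd x) + of_real (fst x) \<noteq> 0" if "x \<in> {0..1} \<times> {0..1}" for x
    using that assms(2) by (intro segment_to_1_nonzero) auto
  then show ?thesis
    unfolding har_kernel_def by (intro continuous_intros 1) auto
qed

text \<open>A parameter integral with jointly continuous integrand. This continuity is what makes
  the integrals over \<open>s\<close> exist.\<close>

lemma continuous_on_slit_fc_har_kernel:
  assumes "mat_spectrum A \<subseteq> - \<real>\<^sub>\<le>\<^sub>0"
  shows "continuous_on {0..1} (\<lambda>s. slit_fc (har_kernel s) A $ i $ j)"
proof -
  obtain \<gamma> \<kappa> :: "real \<Rightarrow> complex" where \<gamma>: "continuous_on {0..1} \<gamma>" "\<gamma> ` {0..1} \<subseteq> - \<real>\<^sub>\<le>\<^sub>0" and \<kappa>: "continuous_on {0..1} \<kappa>"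
    and eq: "\<And>f. f holomorphic_on - \<real>\<^sub>\<le>\<^sub>0 \<Longrightarrow> slit_fc f A $ i $ j = integral {0..1} (\<lambda>u. f (\<gamma> u) * \<kappa> u)"
    using slit_fc_entry_integral[OF assms, of i j] by metis
  have "continuous_on ({0..1} \<times> {0..1}) (\<lambda>x. \<kappa> (snd x :: real))"
    by (rule continuous_on_compose2[OF \<kappa>]) (auto intro!: continuous_intros)
  then have "continuous_on ({0..1} \<times> cbox 0 1) (\<lambda>(s, u). har_kernel s (\<gamma> u) * \<kappa> u)"
    unfolding case_prod_beta cbox_interval
    by (intro continuous_on_mult continuous_on_har_kernel_path \<gamma>)
  then have "continuous_on {0..1} (\<lambda>s. integral (cbox 0 1) (\<lambda>u. har_kernel s (\<gamma> u) * \<kappa> u))"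
    by (rule integral_continuous_on_param)
  then show ?thesis
    by (rule continuous_on_eq) (simp add: eq[OF holomorphic_har_kernel])
qed

lemma holomorphic_powr_slit: "(\<lambda>z. z powr c) holomorphic_on - \<real>\<^sub>\<le>\<^sub>0"
  by (auto intro!: holomorphic_intros)

text \<open>After exchanging the two integrals, the inner one is the truncated and normalised Beta
  mixture at points of the contour, a compact subset of the slit plane, where it converges
  uniformly.\<close>

lemma slit_fc_powr_limit:
  assumes spec: "mat_spectrum A \<subseteq> - \<real>\<^sub>\<le>\<^sub>0" and t: "0 < t" "t < 1"
  shows "(\<lambda>n. integral {cutoff n..1 - cutoff n} (\<lambda>s. of_real (beta_weight t s) * slit_fc (har_kernel s) A $ i $ j)
      / of_real (beta_mass t n)) \<longlonglongrightarrow> slit_fc (\<lambda>z. z powr of_real t) A $ i $ j"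
proof -
  obtain \<gamma> \<kappa> :: "real \<Rightarrow> complex" where \<gamma>: "continuous_on {0..1} \<gamma>" "\<gamma> ` {0..1} \<subseteq> - \<real>\<^sub>\<le>\<^sub>0" and \<kappa>: "continuous_on {0..1} \<kappa>"
    and eq: "\<And>f. f holomorphic_on - \<real>\<^sub>\<le>\<^sub>0 \<Longrightarrow> slit_fc f A $ i $ j = integral {0..1} (\<lambda>u. f (\<gamma> u) * \<kappa> u)"
    using slit_fc_entry_integral[OF spec, of i j] by metis
  define F where "F n z = integral {cutoff n..1 - cutoff n} (\<lambda>s. of_real (beta_weight t s) * har_kernel s z) / of_real (beta_mass t n)" for n z
  have cont2: "continuous_on (cbox (0, cutoff n) (1, 1 - cutoff n)) (\<lambda>(u, s). of_real (beta_weight t s) * har_kernel s (\<gamma> u))" for n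
  proof -
    have sub: "cbox (0 :: real, cutoff n) (1, 1 - cutoff n) = {0..1} \<times> {cutoff n..1 - cutoff n}" by (auto simp: cbox_Pair_eq)
    have "continuous_on ({0..1} \<times> {cutoff n..1 - cutoff n}) (\<lambda>x. har_kernel (fst (prod.swap x)) (\<gamma> (snd (prod.swap x))))"
      using cutoff[of n]
      by (intro continuous_on_compose2[OF continuous_on_har_kernel_path[OF \<gamma>]] continuous_on_swap) auto
    moreover have "continuous_on ({0..1} \<times> {cutoff n..1 - cutoff n}) (\<lambda>x. beta_weight t (snd x :: real))"
      using cutoff[of n] by (intro continuous_on_compose2[OF continuous_on_beta_weight[of "cutoff n" "1 - cutoff n"]]) (auto intro!: continuous_intros)
    ultimately show ?thesis
      unfolding sub case_prod_beta by (auto intro!: continuous_intros)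
  qed
  have cont2': "continuous_on (cbox (0, cutoff n) (1, 1 - cutoff n)) (\<lambda>(u, s). of_real (beta_weight t s) * har_kernel s (\<gamma> u) * \<kappa> u)" for n
  proof -
    have "continuous_on (cbox (0, cutoff n) (1, 1 - cutoff n)) (\<lambda>x. \<kappa> (fst x))"
      by (rule continuous_on_compose2[OF \<kappa>]) (auto intro!: continuous_intros simp: cbox_Pair_eq)
    then show ?thesis using continuous_on_mult[OF cont2] by (simp add: case_prod_beta)
  qed
  have swap: "integral {cutoff n..1 - cutoff n} (\<lambda>s. of_real (beta_weight t s) * slit_fc (har_kernel s) A $ i $ j)
      / of_real (beta_mass t n) = integral {0..1} (\<lambda>u. F n (\<gamma> u) * \<kappa> u)" for n
  proof -
    have "integral {cutoff n..1 - cutoff n} (\<lambda>s. of_real (beta_weight t s) * slit_fc (har_kernel s) A $ i $ j)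
      = integral {cutoff n..1 - cutoff n} (\<lambda>s. integral {0..1} (\<lambda>u. of_real (beta_weight t s) * har_kernel s (\<gamma> u) * \<kappa> u))"
    proof (rule integral_cong)
      fix s assume "s \<in> {cutoff n..1 - cutoff n}"
      then have "0 \<le> s" "s \<le> 1" using cutoff[of n] by auto
      then show "of_real (beta_weight t s) * slit_fc (har_kernel s) A $ i $ j
          = integral {0..1} (\<lambda>u. of_real (beta_weight t s) * har_kernel s (\<gamma> u) * \<kappa> u)"
        by (simp add: eq[OF holomorphic_har_kernel] mult.assoc)
    qed
    also have "\<dots> = integral {0..1} (\<lambda>u. integral {cutoff n..1 - cutoff n} (\<lambda>s. of_real (beta_weight t s) * har_kernel s (\<gamma> u) * \<kappa> u))"
      using integral_swap_continuous[OF cont2'[of n]] by simp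
    also have "\<dots> = integral {0..1} (\<lambda>u. integral {cutoff n..1 - cutoff n} (\<lambda>s. of_real (beta_weight t s) * har_kernel s (\<gamma> u)) * \<kappa> u)"
      by simp
    finally show ?thesis by (simp add: F_def)
  qed
  have F_cont: "continuous_on {0..1} (\<lambda>u. F n (\<gamma> u))" for n
  proof -
    have "continuous_on ({0..1} \<times> cbox (cutoff n) (1 - cutoff n)) (\<lambda>(u, s). of_real (beta_weight t s) * har_kernel s (\<gamma> u))"
      using cont2[of n] by (simp add: cbox_Pair_eq)
    from integral_continuous_on_param[OF this] show ?thesis
      unfolding F_def using beta_mass_pos[OF t, of n] by (auto intro!: continuous_intros)
  qed
  have lim_cont: "continuous_on {0..1} (\<lambda>u. \<gamma> u powr of_real t)"
    using \<gamma> by (intro continuous_on_powr_complex continuous_intros) (force simp: complex_nonpos_Reals_iff)+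
  have "uniform_limit (\<gamma> ` {0..1}) F (\<lambda>z. z powr of_real t) sequentially"
    unfolding F_def by (intro uniform_limit_powr t compact_continuous_image \<gamma>) auto
  then have "uniform_limit {0..1} (\<lambda>n u. F n (\<gamma> u)) (\<lambda>u. \<gamma> u powr of_real t) sequentially"
    by (auto simp: uniform_limit_iff)
  then have ul: "uniform_limit (cbox 0 1) (\<lambda>n u. F n (\<gamma> u) * \<kappa> u) (\<lambda>u. \<gamma> u powr of_real t * \<kappa> u) sequentially"
    unfolding cbox_interval
    by (intro uniform_lim_mult uniform_limit_const compact_imp_bounded compact_continuous_image lim_cont \<kappa>) auto
  have "continuous_on (cbox 0 1) (\<lambda>u. F n (\<gamma> u) * \<kappa> u)" for n
    unfolding cbox_interval by (intro continuous_on_mult F_cont \<kappa>)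
  then obtain I J where I: "\<And>n. ((\<lambda>u. F n (\<gamma> u) * \<kappa> u) has_integral I n) (cbox 0 1)"
    and J: "((\<lambda>u. \<gamma> u powr of_real t * \<kappa> u) has_integral J) (cbox 0 1)" and IJ: "I \<longlonglongrightarrow> J"
    using uniform_limit_integral_cbox[OF ul _ sequentially_bot] by metis
  have "slit_fc (\<lambda>z. z powr of_real t) A $ i $ j = J"
    using integral_unique[OF J] eq[OF holomorphic_powr_slit[of "of_real t"]] by simp
  moreover have "I = (\<lambda>n. integral {cutoff n..1 - cutoff n} (\<lambda>s. of_real (beta_weight t s) * slit_fc (har_kernel s) A $ i $ j)
      / of_real (beta_mass t n))"
    using integral_unique[OF I] swap by (simp add: fun_eq_iff)
  ultimately show ?thesis using IJ by simp
qed

section \<open>Quadratic forms and sectorial matrices\<close>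

lemma cinner_add_left: "cinner (x + y) z = cinner x z + cinner y z"
  and cinner_add_right: "cinner z (x + y) = cinner z x + cinner z y"
  by (simp_all add: cinner_def sum.distrib algebra_simps)

lemma cinner_diff_left: "cinner (x - y) z = cinner x z - cinner y z"
  and cinner_diff_right: "cinner z (x - y) = cinner z x - cinner z y"
  by (simp_all add: cinner_def sum_subtractf algebra_simps)

lemma cinner_0_left [simp]: "cinner 0 y = 0"
  and cinner_0_right [simp]: "cinner y 0 = 0"
  by (simp_all add: cinner_def)

lemma cinner_scale_left [simp]: "cinner (c *s x) y = c * cinner x y"
  and cinner_scale_right [simp]: "cinner x (c *s y) = cnj c * cinner x y"
  by (simp_all add: cinner_def sum_distrib_left algebra_simps)

lemma scaleR_eq_scale: "r *\<^sub>R x = of_real r *s (x :: complex ^ 'n::finite)"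
  by (simp add: vec_eq_iff scaleR_conv_of_real [where 'a = complex])

lemma cinner_scaleR_left [simp]: "cinner (r *\<^sub>R x) y = of_real r * cinner x y"
  and cinner_scaleR_right [simp]: "cinner x (r *\<^sub>R y) = of_real r * cinner x y"
  by (simp_all add: scaleR_eq_scale)

lemma cinner_commute: "cinner y x = cnj (cinner x y)"
  by (simp add: cinner_def mult.commute)

lemma cinner_self_Re: "Re (cinner x x) = (\<Sum>i\<in>UNIV. (norm (x $ i))\<^sup>2)"
  by (simp add: cinner_def cmod_power2 flip: power2_eq_square)

lemma cinner_self_Im: "Im (cinner x x) = 0"
  by (simp add: cinner_def)

lemma cinner_self_nonneg: "0 \<le> Re (cinner x x)"
  unfolding cinner_self_Re by (intro sum_nonneg) auto

lemma cinner_self_eq_0: "cinner x x = 0 \<Longrightarrow> x = 0"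
proof -
  assume "cinner x x = 0"
  then have "(\<Sum>i\<in>UNIV. (norm (x $ i))\<^sup>2) = 0" by (simp flip: cinner_self_Re)
  then show "x = 0" by (subst (asm) sum_nonneg_eq_0_iff) (auto simp: vec_eq_iff)
qed

lemma matrix_vector_mult_scale [simp]: "A *v (c *s x) = c *s (A *v (x :: complex ^ 'n::finite))"
  by (simp add: vec_eq_iff matrix_vector_mult_def sum_distrib_left algebra_simps)

lemma cinner_adjoint: "cinner (adjoint_mat A *v x) y = cinner x (A *v y)"
proof -
  have "cinner (adjoint_mat A *v x) y = (\<Sum>i\<in>UNIV. \<Sum>j\<in>UNIV. cnj (A $ j $ i) * x $ j * cnj (y $ i))"
    by (simp add: cinner_def matrix_vector_mult_def adjoint_mat_def sum_distrib_right)
  also have "\<dots> = (\<Sum>j\<in>UNIV. \<Sum>i\<in>UNIV. cnj (A $ j $ i) * x $ j * cnj (y $ i))"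
    by (rule sum.swap)
  also have "\<dots> = cinner x (A *v y)"
    by (simp add: cinner_def matrix_vector_mult_def sum_distrib_left mult_ac)
  finally show ?thesis .
qed

abbreviation form :: "'n::finite cmat \<Rightarrow> complex ^ 'n \<Rightarrow> complex" where
  "form A x \<equiv> cinner (A *v x) x"

lemma cmat_scaleR_mult_vec: "(r *\<^sub>R A) *v x = r *\<^sub>R (A *v (x :: complex ^ 'n::finite))"
  by (simp add: vec_eq_iff matrix_vector_mult_def scaleR_sum_right)

lemma form_real_part: "form (real_part A) x = of_real (Re (form A x))"
proof -
  have "form (real_part A) x = (form A x + cnj (form A x)) / 2"
    by (simp add: real_part_def cmat_scaleR_mult_vec matrix_vector_mult_add_rdistrib cinner_add_left
        cinner_adjoint cinner_commute[of x])
  then show ?thesis by (simp add: complex_add_cnj)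
qed

text \<open>Over the complex numbers a matrix with vanishing quadratic form is zero: polarising at
  \<open>x, y\<close> and at \<open>\<i> *s x, y\<close> isolates the inner product of
  \<open>B *v x\<close> with \<open>y\<close>, and \<open>y = B *v x\<close> finishes.\<close>

lemma hermitian_if_form_real:
  assumes "\<And>x. Im (form A x) = 0"
  shows "hermitian_mat A"
proof -
  define B where "B = adjoint_mat A - A"
  have form_B: "form B x = 0" for x
  proof -
    have "form B x = cnj (form A x) - form A x"
      by (simp add: B_def matrix_vector_mult_diff_rdistrib cinner_diff_left cinner_adjoint cinner_commute[of x])
    then show ?thesis using assms[of x] by (simp add: complex_eq_iff)
  qed
  have "B *v x = 0" for x
  proof (rule cinner_self_eq_0)
    define y where "y = B *v x"
    have polar: "cinner (B *v u) v + cinner (B *v v) u = 0" for u v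
      using form_B[of "u + v"] form_B[of u] form_B[of v]
      by (simp add: matrix_vector_right_distrib cinner_add_left cinner_add_right add.commute)
    show "cinner (B *v x) (B *v x) = 0"
      using polar[of x y] polar[of "\<i> *s x" y] by (simp add: y_def[symmetric])
  qed
  then have "B = 0" by (simp add: matrix_eq)
  then show ?thesis by (simp add: hermitian_mat_def B_def)
qed

text \<open>\<open>loewner_le\<close> demands that both sides be Hermitian; here this follows from
  their forms being real, so the mean on the right can be handled through its form alone.\<close>

lemma loewner_leI:
  assumes "\<And>x. Im (form X x) = 0" "\<And>x. Im (form Y x) = 0" "\<And>x. Re (form X x) \<le> Re (form Y x)"
  shows "loewner_le X Y"
proof -
  have "form (Y - X) x = form Y x - form X x" for x
    by (simp add: matrix_vector_mult_diff_rdistrib cinner_diff_left)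
  then show ?thesis
    using assms by (auto simp: loewner_le_def pos_semidef_def intro!: hermitian_if_form_real)
qed

section \<open>Accretive matrices and the sector condition\<close>

definition accretive :: "'n::finite cmat \<Rightarrow> bool" where
  "accretive A \<longleftrightarrow> (\<forall>x. x \<noteq> 0 \<longrightarrow> 0 < Re (form A x))"

definition sector_bound :: "real \<Rightarrow> 'n::finite cmat \<Rightarrow> bool" where
  "sector_bound \<tau> A \<longleftrightarrow> (\<forall>x. \<bar>Im (form A x)\<bar> \<le> \<tau> * Re (form A x))"

lemma sectorial_imp:
  assumes "A \<in> sectorial \<alpha>"
  shows "accretive A" "sector_bound (tan \<alpha>) A"
proof -
  have *: "0 < Re (form A x) \<and> \<bar>Im (form A x)\<bar> \<le> tan \<alpha> * Re (form A x)" if "x \<noteq> 0" for x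
  proof -
    define u where "u = (1 / norm x) *\<^sub>R x"
    have "norm u = 1" using that by (simp add: u_def)
    then have u: "0 < Re (form A u)" "\<bar>Im (form A u)\<bar> \<le> tan \<alpha> * Re (form A u)"
      using assms by (auto simp: sectorial_def)
    have "form A (c *\<^sub>R u) = of_real (c\<^sup>2) * form A u" for c
      by (simp add: scaleR_eq_scale power2_eq_square)
    moreover have "norm x *\<^sub>R u = x" using that by (simp add: u_def)
    ultimately have "form A x = of_real ((norm x)\<^sup>2) * form A u" by metis
    then have "Re (form A x) = (norm x)\<^sup>2 * Re (form A u)" "\<bar>Im (form A x)\<bar> = (norm x)\<^sup>2 * \<bar>Im (form A u)\<bar>"
      by (simp_all add: abs_mult)
    moreover have "(norm x)\<^sup>2 > 0" using that by simp
    moreover have "(norm x)\<^sup>2 * \<bar>Im (form A u)\<bar> \<le> (norm x)\<^sup>2 * (tan \<alpha> * Re (form A u))"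
      using u(2) by (intro mult_left_mono) auto
    ultimately show ?thesis using u(1) by (simp add: mult.left_commute)
  qed
  then show "accretive A" by (simp add: accretive_def)
  have "\<bar>Im (form A x)\<bar> \<le> tan \<alpha> * Re (form A x)" for x
    using *[of x] by (cases "x = 0") auto
  then show "sector_bound (tan \<alpha>) A" by (simp add: sector_bound_def)
qed

lemma accretive_nonneg: "accretive A \<Longrightarrow> 0 \<le> Re (form A x)"
  by (cases "x = 0") (auto simp: accretive_def less_imp_le)

text \<open>Polarise the sector condition at \<open>\<tau> b \<plusminus> \<i> (a - b)\<close>.\<close>

lemma sector_bound_cross:
  assumes A: "accretive A" "sector_bound \<tau> A" and \<tau>: "0 \<le> \<tau>"
  shows "2 * Re (cinner (A *v a) b) \<le> Re (form A a) + (1 + \<tau>\<^sup>2) * Re (form A b)"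
proof -
  define e where "e = a - b"
  have a: "a = e + b" by (simp add: e_def)
  define \<Delta> where "\<Delta> = Re (cinner (A *v e) b) - Re (cinner (A *v b) e)"
  \<comment> \<open>\<open>\<Delta>\<close> is the antisymmetric part of the real bilinear form, the
    obstruction to completing the square. Between the two test vectors the imaginary parts differ by
    a multiple of \<open>\<Delta>\<close>, while the cross terms of the real parts cancel in the
    sum.\<close>
  have k: "k * \<Delta> \<le> \<tau> * (k\<^sup>2 * Re (form A b) + Re (form A e))" for k
  proof -
    define yp where "yp = of_real k *s b + \<i> *s e"
    define ym where "ym = of_real k *s b + (- \<i>) *s e"
    define Q where "Q = k\<^sup>2 * Re (form A b) + Re (form A e)"
    have 1: "Im (form A yp) - Im (form A ym) = 2 * (k * \<Delta>)"
      by (simp add: yp_def ym_def \<Delta>_def matrix_vector_right_distrib cinner_add_left cinner_add_right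
          cinner_diff_left cinner_diff_right algebra_simps)
    have 2: "Re (form A yp) + Re (form A ym) = 2 * Q"
      by (simp add: yp_def ym_def Q_def matrix_vector_right_distrib cinner_add_left cinner_add_right
          cinner_diff_left cinner_diff_right algebra_simps power2_eq_square)
    have "Im (form A yp) - Im (form A ym) \<le> \<tau> * (Re (form A yp) + Re (form A ym))"
      using A(2)[unfolded sector_bound_def, rule_format, of yp] A(2)[unfolded sector_bound_def, rule_format, of ym]
      by (simp add: distrib_left abs_le_iff)
    then have "k * \<Delta> \<le> \<tau> * Q" unfolding 1 2 by simp
    then show ?thesis by (simp add: Q_def)
  qed
  have "\<Delta> \<le> \<tau>\<^sup>2 * Re (form A b) + Re (form A e)"
  \<comment> \<open>\<open>k = \<tau>\<close> produces the factor \<open>\<tau>\<^sup>2\<close>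
    after division by \<open>\<tau>\<close>. For \<open>\<tau> = 0\<close> any positive
    \<open>k\<close> gives \<open>\<Delta> \<le> 0\<close>.\<close>
  proof (cases "\<tau> = 0")
    case True
    then show ?thesis using k[of 1] accretive_nonneg[OF A(1), of e] by simp
  next
    case False
    then show ?thesis using k[of \<tau>] \<tau> by simp
  qed
  moreover have "Re (form A a) - 2 * Re (cinner (A *v a) b) + Re (form A b) = Re (form A e) - \<Delta>"
    by (simp add: a \<Delta>_def matrix_vector_right_distrib cinner_add_left cinner_add_right)
  ultimately show ?thesis by (simp add: algebra_simps)
qed

lemma mat_mult_vec: "mat c *v x = c *s (x :: complex ^ 'n::finite)"
proof -
  have "mat c $ i $ j * x $ j = (if j = i then c * x $ i else 0)" for i j
    by (simp add: mat_component)
  then show ?thesis by (simp add: vec_eq_iff matrix_vector_mult_def)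
qed

text \<open>An eigenvector \<open>x\<close> for \<open>z\<close> turns into
  \<open>Y *v y = z *s (X *v y)\<close> with \<open>y = N *v x\<close>. Thus \<open>z\<close> is the
  quotient of the forms of \<open>Y\<close> and \<open>X\<close> at \<open>y\<close>, two numbers in
  the open right half-plane, and such a quotient is never a nonpositive real.\<close>

lemma spectrum_congruence:
  assumes X: "accretive X" and Y: "accretive Y" and PP: "P ** P = X" and PN: "P ** N = mat 1" and NP: "N ** P = mat 1"
  shows "mat_spectrum (N ** Y ** N) \<subseteq> - \<real>\<^sub>\<le>\<^sub>0"
proof
  fix z assume "z \<in> mat_spectrum (N ** Y ** N)"
  then have "\<not> invertible (mat z - N ** Y ** N)" by (simp add: mat_spectrum_def)
  then obtain x where x: "(mat z - N ** Y ** N) *v x = 0" "x \<noteq> 0"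
    using invertible_if_kernel_trivial by blast
  define y where "y = N *v x"
  have Py: "P *v y = x" using PN by (simp add: y_def matrix_vector_mul_assoc)
  then have "y \<noteq> 0" using x(2) by auto
  have "P *v (z *s x) = P *v ((N ** Y ** N) *v x)"
    using x(1) by (simp add: matrix_vector_mult_diff_rdistrib mat_mult_vec)
  also have "\<dots> = Y *v y"
    by (simp add: y_def matrix_vector_mul_assoc matrix_mul_assoc PN)
  finally have "z *s (X *v y) = Y *v y"
    by (simp add: Py[symmetric] matrix_vector_mul_assoc PP)
  then have "Re (z * form X y) = Re (form Y y)" by (metis cinner_scale_left)
  then have "0 < Re (z * form X y)" using Y \<open>y \<noteq> 0\<close> by (simp add: accretive_def)
  moreover have "0 < Re (form X y)" using X \<open>y \<noteq> 0\<close> by (simp add: accretive_def)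
  ultimately have "Im z = 0 \<Longrightarrow> 0 < Re z" by (simp add: zero_less_mult_iff)
  then show "z \<in> - \<real>\<^sub>\<le>\<^sub>0" by (auto simp: complex_nonpos_Reals_iff)
qed

lemma spectrum_accretive: "accretive (X :: 'a::finite cmat) \<Longrightarrow> mat_spectrum X \<subseteq> - \<real>\<^sub>\<le>\<^sub>0"
proof -
  assume X: "accretive X"
  have "accretive (mat 1 :: 'a cmat)"
    using cinner_self_nonneg cinner_self_eq_0
    by (fastforce simp: accretive_def less_le complex_eq_iff cinner_self_Im)
  then show ?thesis
    using spectrum_congruence[of "mat 1" X "mat 1" "mat 1"] X by simp
qed

text \<open>Exponents add under the calculus, so all three products reduce to the functions
  \<open>z\<close> and 1. The later manipulations of the means use the two powers through these
  identities.\<close>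

lemma mat_powr_sqrt:
  assumes "accretive X"
  shows "mat_powr X (1/2) ** mat_powr X (1/2) = X"
    "mat_powr X (1/2) ** mat_powr X (-1/2) = mat 1" "mat_powr X (-1/2) ** mat_powr X (1/2) = mat 1"
proof -
  note spec = spectrum_accretive[OF assms]
  have pm: "z powr of_real r * z powr of_real s = z powr of_real (r + s)" if "z \<notin> \<real>\<^sub>\<le>\<^sub>0" for z :: complex and r s
    by (simp add: powr_add)
  have pw: "mat_powr X r ** mat_powr X s = slit_fc (\<lambda>z. z powr of_real (r + s)) X" for r s
    unfolding mat_powr_def
    by (rule slit_fc_mult[OF spec holomorphic_powr_slit holomorphic_powr_slit, symmetric]) (simp add: pm)
  show "mat_powr X (1/2) ** mat_powr X (1/2) = X"
    unfolding pw by (rule slit_fc_ident[OF spec]) simp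
  show "mat_powr X (1/2) ** mat_powr X (-1/2) = mat 1"
    unfolding pw by (rule slit_fc_const[OF spec]) auto
  show "mat_powr X (-1/2) ** mat_powr X (1/2) = mat 1"
    unfolding pw by (rule slit_fc_const[OF spec]) auto
qed

section \<open>Weighted harmonic and geometric means\<close>

text \<open>Equal to \<open>((1 - s) X\<inverse> + s Y\<inverse>)\<inverse>\<close>.\<close>

definition har_mean :: "real \<Rightarrow> 'n::finite cmat \<Rightarrow> 'n cmat \<Rightarrow> 'n cmat" where
  "har_mean s X Y =
     mat_powr X (1/2) ** slit_fc (har_kernel s) (mat_powr X (-1/2) ** Y ** mat_powr X (-1/2)) ** mat_powr X (1/2)"

lemma spectrum_geom_mean:
  "accretive X \<Longrightarrow> accretive Y \<Longrightarrow>
    mat_spectrum (mat_powr X (-1/2) ** Y ** mat_powr X (-1/2)) \<subseteq> - \<real>\<^sub>\<le>\<^sub>0"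
  using spectrum_congruence mat_powr_sqrt by metis

text \<open>The endpoints \<open>t = 0\<close> and \<open>t = 1\<close> are evaluated directly,
  because there the Beta weight has a nonintegrable singularity.\<close>

lemma geom_mean_0:
  assumes "accretive X" "accretive Y"
  shows "geom_mean 0 X Y = X"
proof -
  have "mat_powr (mat_powr X (-1/2) ** Y ** mat_powr X (-1/2)) 0 = mat 1"
    unfolding mat_powr_def[of _ 0]
    by (rule slit_fc_const[OF spectrum_geom_mean[OF assms]]) auto
  then show ?thesis by (simp add: geom_mean_def mat_powr_sqrt[OF assms(1)])
qed

lemma sandwich_cancel:
  assumes "P ** N = mat 1" "N ** P = (mat 1 :: 'n::finite cmat)"
  shows "P ** (N ** Y ** N) ** P = Y"
  by (metis assms matrix_mul_assoc matrix_mul_lid matrix_mul_rid)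

lemma geom_mean_1:
  assumes "accretive X" "accretive Y"
  shows "geom_mean 1 X Y = Y"
proof -
  have "mat_powr (mat_powr X (-1/2) ** Y ** mat_powr X (-1/2)) 1 = mat_powr X (-1/2) ** Y ** mat_powr X (-1/2)"
    unfolding mat_powr_def[of _ 1]
    by (rule slit_fc_ident[OF spectrum_geom_mean[OF assms]]) auto
  then show ?thesis
    using sandwich_cancel[OF mat_powr_sqrt(2,3)[OF assms(1)]] by (simp add: geom_mean_def)
qed

text \<open>\<open>E\<close> is the value of \<open>1 / ((1 - s) * z + s)\<close> at
  \<open>M\<close>; multiplicativity of the calculus gives both identities, the second saying that
  \<open>E\<close> inverts the linear denominator.\<close>

lemma slit_fc_har_kernel:
  fixes M :: "'n::finite cmat"
  assumes spec: "mat_spectrum M \<subseteq> - \<real>\<^sub>\<le>\<^sub>0" and s: "0 \<le> s" "s \<le> 1"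
  obtains E where "slit_fc (har_kernel s) M = M ** E"
    "((1 - s) *\<^sub>R M + s *\<^sub>R mat 1) ** E = mat 1"
proof -
  define d where "d z = 1 / (of_real (1 - s) * z + of_real s)" for z :: complex
  have d: "d holomorphic_on - \<real>\<^sub>\<le>\<^sub>0"
    unfolding d_def using segment_to_1_nonzero s by (intro holomorphic_intros) auto
  have "slit_fc (har_kernel s) M = slit_fc (\<lambda>z. z) M ** slit_fc d M"
    by (rule slit_fc_mult[OF spec holomorphic_on_ident d]) (simp add: har_kernel_def d_def)
  then have 1: "slit_fc (har_kernel s) M = M ** slit_fc d M"
    by (simp add: slit_fc_ident[OF spec])
  define g where "g z = of_real (1 - s) * z" for z :: complex
  have g: "g holomorphic_on - \<real>\<^sub>\<le>\<^sub>0" unfolding g_def by (intro holomorphic_intros)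
  have "slit_fc (\<lambda>z. g z + of_real s) M = slit_fc g M + slit_fc (\<lambda>_. of_real s) M"
    by (rule slit_fc_add[OF spec g holomorphic_on_const]) simp
  moreover have "slit_fc g M = slit_fc (\<lambda>_. of_real (1 - s)) M ** slit_fc (\<lambda>z. z) M"
    by (rule slit_fc_mult[OF spec holomorphic_on_const holomorphic_on_ident]) (simp add: g_def)
  moreover have "slit_fc (\<lambda>_. c) M = mat c" for c by (rule slit_fc_const[OF spec]) simp
  ultimately have lin: "slit_fc (\<lambda>z. g z + of_real s) M = (1 - s) *\<^sub>R M + s *\<^sub>R mat 1"
    using mat_of_real_mult[of "1 - s" M] mat_of_real_mult[of s "mat 1 :: 'n cmat"] slit_fc_ident[OF spec, of "\<lambda>z. z"]
    by simp
  have "mat 1 = slit_fc (\<lambda>z. g z + of_real s) M ** slit_fc d M"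
  proof -
    have "slit_fc (\<lambda>_. 1) M = slit_fc (\<lambda>z. g z + of_real s) M ** slit_fc d M"
      using segment_to_1_nonzero s
      by (intro slit_fc_mult[OF spec _ d] holomorphic_intros g) (auto simp: g_def d_def)
    then show ?thesis using slit_fc_const[OF spec, of "\<lambda>_. 1" 1] by simp
  qed
  then show ?thesis using that[OF 1] lin by simp
qed

lemma har_mean_decomposition:
  assumes "accretive X" "accretive Y" and s: "0 \<le> s" "s \<le> 1"
  obtains a b where "X *v a = har_mean s X Y *v x" "Y *v b = har_mean s X Y *v x"
    "x = (1 - s) *\<^sub>R a + s *\<^sub>R b"
proof -
  define P where "P = mat_powr X (1/2)"
  define N where "N = mat_powr X (-1/2)"
  have PN: "P ** P = X" "P ** N = mat 1" "N ** P = mat 1"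
    unfolding P_def N_def by (fact mat_powr_sqrt[OF assms(1)])+
  define M where "M = N ** Y ** N"
  have spec: "mat_spectrum M \<subseteq> - \<real>\<^sub>\<le>\<^sub>0"
    unfolding M_def N_def by (rule spectrum_geom_mean[OF assms(1,2)])
  obtain E where E: "slit_fc (har_kernel s) M = M ** E" "((1 - s) *\<^sub>R M + s *\<^sub>R mat 1) ** E = mat 1"
    using slit_fc_har_kernel[OF spec s] by metis
  have H: "har_mean s X Y = P ** (M ** E) ** P"
    unfolding har_mean_def P_def[symmetric] N_def[symmetric] M_def[symmetric] E(1) ..
  have YP: "Y ** N = P ** M"
    by (simp add: M_def matrix_mul_assoc PN)
  have XP: "X ** N = P"
    by (metis PN matrix_mul_assoc matrix_mul_rid)
  \<comment> \<open>With the mean written as \<open>P ** (M ** E) ** P\<close>, cancelling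
    \<open>X ** N = P\<close> and \<open>Y ** N = P ** M\<close> on its left gives the preimages of
    its value at \<open>x\<close> under \<open>X\<close> and \<open>Y\<close>.\<close>
  define a where "a = N *v ((M ** E ** P) *v x)"
  define b where "b = N *v ((E ** P) *v x)"
  have "X *v a = har_mean s X Y *v x"
    unfolding a_def H matrix_vector_mul_assoc by (simp add: matrix_mul_assoc XP)
  moreover have "Y *v b = har_mean s X Y *v x"
    unfolding b_def H matrix_vector_mul_assoc by (simp add: matrix_mul_assoc YP)
  moreover have "x = (1 - s) *\<^sub>R a + s *\<^sub>R b"
  proof -
    have "N ** (((1 - s) *\<^sub>R M + s *\<^sub>R mat 1) ** E) ** P = mat 1"
      by (simp add: E PN)
    then have "x = (N ** (((1 - s) *\<^sub>R M + s *\<^sub>R mat 1) ** E) ** P) *v x" by simp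
    also have "\<dots> = N *v ((((1 - s) *\<^sub>R M + s *\<^sub>R mat 1)) *v ((E ** P) *v x))"
      by (simp add: matrix_vector_mul_assoc matrix_mul_assoc)
    also have "\<dots> = (1 - s) *\<^sub>R (N *v (M *v ((E ** P) *v x))) + s *\<^sub>R b"
    proof -
      have "N *v (((1 - s) *\<^sub>R M + s *\<^sub>R mat 1) *v w) = (1 - s) *\<^sub>R (N *v (M *v w)) + s *\<^sub>R (N *v w)" for w
        by (simp add: matrix_vector_mult_add_rdistrib cmat_scaleR_mult_vec matrix_vector_right_distrib
            matrix_vector_mult_diff_distrib scaleR_eq_scale)
      then show ?thesis unfolding b_def .
    qed
    also have "N *v (M *v ((E ** P) *v x)) = a"
      by (simp add: a_def matrix_vector_mul_assoc matrix_mul_assoc)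
    finally show ?thesis .
  qed
  ultimately show ?thesis by (rule that)
qed

lemma form_har_mean:
  assumes "X *v a = har_mean s X Y *v x" "Y *v b = har_mean s X Y *v x" "x = (1 - s) *\<^sub>R a' + s *\<^sub>R b'"
  shows "form (har_mean s X Y) x = of_real (1 - s) * cinner (X *v a) a' + of_real s * cinner (Y *v b) b'"
proof -
  have "form (har_mean s X Y) x = cinner (har_mean s X Y *v x) ((1 - s) *\<^sub>R a' + s *\<^sub>R b')"
    using assms(3) by simp
  then show ?thesis
    by (simp only: cinner_add_right cinner_scaleR_right assms(1,2))
qed

lemma har_mean_le:
  assumes "accretive X" "accretive Y" "sector_bound \<tau> X" "sector_bound \<tau> Y" "0 \<le> \<tau>"
    and s: "0 \<le> s" "s \<le> 1" and x: "x = (1 - s) *\<^sub>R a' + s *\<^sub>R b'"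
  shows "Re (form (har_mean s X Y) x) \<le> (1 + \<tau>\<^sup>2) * ((1 - s) * Re (form X a') + s * Re (form Y b'))"
proof -
  obtain a b where ab: "X *v a = har_mean s X Y *v x" "Y *v b = har_mean s X Y *v x"
    and x2: "x = (1 - s) *\<^sub>R a + s *\<^sub>R b"
    using har_mean_decomposition[OF assms(1,2) s] by metis
  define L where "L = Re (form (har_mean s X Y) x)"
  have L1: "L = (1 - s) * Re (form X a) + s * Re (form Y b)"
    unfolding L_def form_har_mean[OF ab x2] by simp
  \<comment> \<open>The same number \<open>L\<close>, now with the second slot expanded along the
    competitor: diagonal terms become cross terms, to which the sectorial inequality
    applies.\<close>
  have "2 * L = (1 - s) * (2 * Re (cinner (X *v a) a')) + s * (2 * Re (cinner (Y *v b) b'))"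
    unfolding L_def form_har_mean[OF ab x] by simp
  also have "\<dots> \<le> (1 - s) * (Re (form X a) + (1 + \<tau>\<^sup>2) * Re (form X a'))
      + s * (Re (form Y b) + (1 + \<tau>\<^sup>2) * Re (form Y b'))"
    using s assms by (intro add_mono mult_left_mono sector_bound_cross) auto
  also have "\<dots> = L + (1 + \<tau>\<^sup>2) * ((1 - s) * Re (form X a') + s * Re (form Y b'))"
    unfolding L1 by (simp add: algebra_simps)
  finally show ?thesis by (simp add: L_def)
qed

text \<open>One decomposition of \<open>x\<close>, the optimal one for \<open>P\<close> and
  \<open>Q\<close>, serves as competitor for the pairs \<open>A, C\<close> and \<open>B, D\<close>
  at once. \<open>P\<close> and \<open>Q\<close> are given through their forms, which is how the
  averages of the four bounds are recognised; that these forms are real makes the form of the mean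
  real.\<close>

lemma har_mean_real_part:
  assumes acc: "accretive A" "accretive B" "accretive C" "accretive D"
    and sec: "sector_bound \<tau> A" "sector_bound \<tau> B" "sector_bound \<tau> C" "sector_bound \<tau> D" "0 \<le> \<tau>"
    and lam: "0 \<le> lam" "lam \<le> 1" and s: "0 \<le> s" "s \<le> 1"
    and P: "accretive P" "\<And>x. form P x = of_real (lam * Re (form A x) + (1 - lam) * Re (form B x))"
    and Q: "accretive Q" "\<And>x. form Q x = of_real (lam * Re (form C x) + (1 - lam) * Re (form D x))"
  shows "lam * Re (form (har_mean s A C) x) + (1 - lam) * Re (form (har_mean s B D) x)
      \<le> (1 + \<tau>\<^sup>2) * Re (form (har_mean s P Q) x)"
    and "Im (form (har_mean s P Q) x) = 0"
proof -
  obtain a b where ab: "P *v a = har_mean s P Q *v x" "Q *v b = har_mean s P Q *v x"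
    and x: "x = (1 - s) *\<^sub>R a + s *\<^sub>R b"
    using har_mean_decomposition[OF P(1) Q(1) s] by metis
  have H: "form (har_mean s P Q) x = of_real ((1 - s) * (lam * Re (form A a) + (1 - lam) * Re (form B a))
      + s * (lam * Re (form C b) + (1 - lam) * Re (form D b)))"
    unfolding form_har_mean[OF ab x] P(2) Q(2) by simp
  then show "Im (form (har_mean s P Q) x) = 0" by simp
  have "lam * Re (form (har_mean s A C) x) + (1 - lam) * Re (form (har_mean s B D) x)
      \<le> lam * ((1 + \<tau>\<^sup>2) * ((1 - s) * Re (form A a) + s * Re (form C b)))
        + (1 - lam) * ((1 + \<tau>\<^sup>2) * ((1 - s) * Re (form B a) + s * Re (form D b)))"
    using acc sec s lam by (intro add_mono mult_left_mono har_mean_le x) auto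
  also have "\<dots> = (1 + \<tau>\<^sup>2) * Re (form (har_mean s P Q) x)"
    unfolding H by (simp add: algebra_simps)
  finally show "lam * Re (form (har_mean s A C) x) + (1 - lam) * Re (form (har_mean s B D) x)
      \<le> (1 + \<tau>\<^sup>2) * Re (form (har_mean s P Q) x)" .
qed

text \<open>The form is a fixed linear functional of the entries of \<open>Z\<close>, so continuity
  and limits of the means can be checked on entries of the functional calculus.\<close>

lemma form_sandwich:
  "form (P ** Z ** P) x = (\<Sum>i\<in>UNIV. \<Sum>j\<in>UNIV. (P *v x) $ j * cnj ((adjoint_mat P *v x) $ i) * Z $ i $ j)"
proof -
  have "form (P ** Z ** P) x = cnj (cinner (adjoint_mat P *v x) (Z *v (P *v x)))"
    by (simp add: cinner_adjoint matrix_vector_mul_assoc matrix_mul_assoc flip: cinner_commute)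
  also have "\<dots> = cinner (Z *v (P *v x)) (adjoint_mat P *v x)"
    by (rule cinner_commute [symmetric])
  also have "\<dots> = (\<Sum>i\<in>UNIV. \<Sum>j\<in>UNIV. (P *v x) $ j * cnj ((adjoint_mat P *v x) $ i) * Z $ i $ j)"
    unfolding cinner_def matrix_vector_mult_def [of Z] by (simp add: sum_distrib_right sum_distrib_left mult_ac)
  finally show ?thesis .
qed

text \<open>\<open>h\<close> stands for \<open>Re\<close> or \<open>Im\<close>: one statement
  provides the limit for the inequality and the one for reality of the form. Real linearity lets
  \<open>h\<close> pass through the weight, the mass and the integral.\<close>

lemma geom_mean_form_limit:
  assumes acc: "accretive X" "accretive Y" and t: "0 < t" "t < 1" and h: "bounded_linear (h :: complex \<Rightarrow> real)"
  shows "continuous_on {0..1} (\<lambda>s. h (form (har_mean s X Y) x))"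
    and "(\<lambda>n. integral {cutoff n..1 - cutoff n} (\<lambda>s. beta_weight t s * h (form (har_mean s X Y) x)) / beta_mass t n)
      \<longlonglongrightarrow> h (form (geom_mean t X Y) x)"
proof -
  define P where "P = mat_powr X (1/2)"
  define M where "M = mat_powr X (-1/2) ** Y ** mat_powr X (-1/2)"
  have spec: "mat_spectrum M \<subseteq> - \<real>\<^sub>\<le>\<^sub>0"
    unfolding M_def by (rule spectrum_geom_mean[OF acc])
  define c where "c i j = (P *v x) $ j * cnj ((adjoint_mat P *v x) $ i)" for i j
  have har: "form (har_mean s X Y) x = (\<Sum>i\<in>UNIV. \<Sum>j\<in>UNIV. c i j * slit_fc (har_kernel s) M $ i $ j)" for s
    unfolding har_mean_def P_def[symmetric] M_def[symmetric] form_sandwich c_def ..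
  have geo: "form (geom_mean t X Y) x = (\<Sum>i\<in>UNIV. \<Sum>j\<in>UNIV. c i j * slit_fc (\<lambda>z. z powr of_real t) M $ i $ j)"
    unfolding geom_mean_def P_def[symmetric] M_def[symmetric] form_sandwich c_def mat_powr_def[of M] ..
  have cont_entry: "continuous_on {0..1} (\<lambda>s. slit_fc (har_kernel s) M $ i $ j)" for i j
    by (rule continuous_on_slit_fc_har_kernel[OF spec])
  have cont: "continuous_on {0..1} (\<lambda>s. form (har_mean s X Y) x)"
    unfolding har by (intro continuous_on_sum continuous_on_mult continuous_on_const cont_entry)
  then show "continuous_on {0..1} (\<lambda>s. h (form (har_mean s X Y) x))"
    by (rule bounded_linear.continuous_on[OF h])
  define I where "I n i j = integral {cutoff n..1 - cutoff n} (\<lambda>s. of_real (beta_weight t s) * slit_fc (har_kernel s) M $ i $ j)" for n i j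
  define J where "J n = integral {cutoff n..1 - cutoff n} (\<lambda>s. of_real (beta_weight t s) * form (har_mean s X Y) x)" for n
  have sub: "{cutoff n..1 - cutoff n} \<subseteq> {0..1}" for n using cutoff[of n] by auto
  have cw: "continuous_on {cutoff n..1 - cutoff n} (\<lambda>s. of_real (beta_weight t s) :: complex)" for n
    using cutoff[of n] by (intro continuous_on_of_real continuous_on_beta_weight)
  have J_eq: "J n = (\<Sum>i\<in>UNIV. \<Sum>j\<in>UNIV. c i j * I n i j)" for n
  proof -
    have int: "(\<lambda>s. c i j * (of_real (beta_weight t s) * slit_fc (har_kernel s) M $ i $ j)) integrable_on {cutoff n..1 - cutoff n}" for i j
      by (intro integrable_continuous_interval continuous_on_mult continuous_on_const cw
          continuous_on_subset[OF cont_entry sub])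
    have "J n = integral {cutoff n..1 - cutoff n}
        (\<lambda>s. \<Sum>i\<in>UNIV. \<Sum>j\<in>UNIV. c i j * (of_real (beta_weight t s) * slit_fc (har_kernel s) M $ i $ j))"
      unfolding J_def har by (simp add: sum_distrib_left mult_ac)
    also have "\<dots> = (\<Sum>i\<in>UNIV. \<Sum>j\<in>UNIV. integral {cutoff n..1 - cutoff n}
        (\<lambda>s. c i j * (of_real (beta_weight t s) * slit_fc (har_kernel s) M $ i $ j)))"
      by (simp add: integral_sum integrable_sum int)
    finally show ?thesis by (simp add: I_def)
  qed
  have "(\<lambda>n. \<Sum>i\<in>UNIV. \<Sum>j\<in>UNIV. c i j * (I n i j / of_real (beta_mass t n))) \<longlonglongrightarrow> form (geom_mean t X Y) x"
    unfolding geo I_def by (intro tendsto_sum tendsto_mult tendsto_const slit_fc_powr_limit spec t)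
  then have "(\<lambda>n. J n / of_real (beta_mass t n)) \<longlonglongrightarrow> form (geom_mean t X Y) x"
    by (simp add: J_eq sum_divide_distrib)
  then have "(\<lambda>n. h (J n / of_real (beta_mass t n))) \<longlonglongrightarrow> h (form (geom_mean t X Y) x)"
    by (rule bounded_linear.tendsto[OF h])
  moreover have "h (J n / of_real (beta_mass t n))
      = integral {cutoff n..1 - cutoff n} (\<lambda>s. beta_weight t s * h (form (har_mean s X Y) x)) / beta_mass t n" for n
  proof -
    have hs: "h (of_real r * w) = r * h w" for r w
      using linear_scale[OF bounded_linear.linear[OF h], of r w] by (simp add: scaleR_conv_of_real)
    have "h (J n) = integral {cutoff n..1 - cutoff n} (h \<circ> (\<lambda>s. of_real (beta_weight t s) * form (har_mean s X Y) x))"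
      unfolding J_def
      by (rule integral_linear[OF _ h, symmetric])
         (intro integrable_continuous_interval continuous_on_mult cw continuous_on_subset[OF cont sub])
    moreover have "h (J n / of_real (beta_mass t n)) = h (J n) / beta_mass t n"
      using hs[of "1 / beta_mass t n" "J n"] by simp
    ultimately show ?thesis by (simp add: o_def hs)
  qed
  ultimately show "(\<lambda>n. integral {cutoff n..1 - cutoff n} (\<lambda>s. beta_weight t s * h (form (har_mean s X Y) x)) / beta_mass t n)
      \<longlonglongrightarrow> h (form (geom_mean t X Y) x)" by simp
qed

text \<open>For \<open>0 < t < 1\<close> the harmonic inequality is multiplied by the nonnegative
  weight, integrated over the truncated interval and divided by the positive mass; it then survives
  the limit. Reality of the form passes to the limit in the same way.\<close>

lemma geom_mean_real_part:
  assumes acc: "accretive A" "accretive B" "accretive C" "accretive D"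
    and sec: "sector_bound \<tau> A" "sector_bound \<tau> B" "sector_bound \<tau> C" "sector_bound \<tau> D" "0 \<le> \<tau>"
    and lam: "0 \<le> lam" "lam \<le> 1" and t: "0 \<le> t" "t \<le> 1"
    and P: "accretive P" "\<And>x. form P x = of_real (lam * Re (form A x) + (1 - lam) * Re (form B x))"
    and Q: "accretive Q" "\<And>x. form Q x = of_real (lam * Re (form C x) + (1 - lam) * Re (form D x))"
  shows "lam * Re (form (geom_mean t A C) x) + (1 - lam) * Re (form (geom_mean t B D) x)
      \<le> (1 + \<tau>\<^sup>2) * Re (form (geom_mean t P Q) x) \<and> Im (form (geom_mean t P Q) x) = 0"
proof -
  \<comment> \<open>Settles the endpoints: there the two sides are \<open>r\<close> and
    \<open>(1 + \<tau>\<^sup>2) * r\<close> with the same nonnegative \<open>r\<close>.\<close>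
  have scale: "r \<le> (1 + \<tau>\<^sup>2) * r" if "0 \<le> r" for r :: real
    using that by (simp add: distrib_right)
  consider "t = 0" | "t = 1" | "0 < t" "t < 1" using t by linarith
  then show ?thesis
  proof cases
    case 1
    have "0 \<le> lam * Re (form A x) + (1 - lam) * Re (form B x)"
      using lam acc accretive_nonneg by (intro add_nonneg_nonneg mult_nonneg_nonneg) auto
    from scale[OF this] show ?thesis
      using acc P Q by (simp add: 1 geom_mean_0)
  next
    case 2
    have "0 \<le> lam * Re (form C x) + (1 - lam) * Re (form D x)"
      using lam acc accretive_nonneg by (intro add_nonneg_nonneg mult_nonneg_nonneg) auto
    from scale[OF this] show ?thesis
      using acc P Q by (simp add: 2 geom_mean_1)
  next
    case 3
    define S where "S n = {cutoff n..1 - cutoff n}" for n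
    note lim_Re = geom_mean_form_limit(2)[OF _ _ 3 bounded_linear_Re, of _ _ x, folded S_def]
    note lim_Im = geom_mean_form_limit(2)[OF P(1) Q(1) 3 bounded_linear_Im, of x, folded S_def]
    have S: "0 \<le> s" "s \<le> 1" if "s \<in> S n" for s n using that cutoff[of n] by (auto simp: S_def)
    have int: "(\<lambda>s. beta_weight t s * Re (form (har_mean s X Y) x)) integrable_on S n"
      if "accretive X" "accretive Y" for X Y n
      unfolding S_def using cutoff[of n]
      by (intro integrable_continuous_interval continuous_on_mult continuous_on_beta_weight
          continuous_on_subset[OF geom_mean_form_limit(1)[OF that 3 bounded_linear_Re]]) auto
    note har = har_mean_real_part[OF acc sec lam _ _ P Q]
    have "(\<lambda>n. integral (S n) (\<lambda>s. beta_weight t s * Im (form (har_mean s P Q) x)) / beta_mass t n) = (\<lambda>_. 0)"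
    proof
      fix n
      have "integral (S n) (\<lambda>s. beta_weight t s * Im (form (har_mean s P Q) x)) = integral (S n) (\<lambda>_. 0)"
        by (rule integral_cong) (use har(2) S in auto)
      then show "integral (S n) (\<lambda>s. beta_weight t s * Im (form (har_mean s P Q) x)) / beta_mass t n = 0" by simp
    qed
    with lim_Im have "Im (form (geom_mean t P Q) x) = 0"
      by (simp add: LIMSEQ_const_iff)
    moreover have "lam * Re (form (geom_mean t A C) x) + (1 - lam) * Re (form (geom_mean t B D) x)
      \<le> (1 + \<tau>\<^sup>2) * Re (form (geom_mean t P Q) x)"
    proof (rule LIMSEQ_le)
      let ?I = "\<lambda>X Y n. integral (S n) (\<lambda>s. beta_weight t s * Re (form (har_mean s X Y) x))"
      show "(\<lambda>n. lam * (?I A C n / beta_mass t n) + (1 - lam) * (?I B D n / beta_mass t n))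
          \<longlonglongrightarrow> lam * Re (form (geom_mean t A C) x) + (1 - lam) * Re (form (geom_mean t B D) x)"
        by (intro tendsto_add tendsto_mult tendsto_const lim_Re acc)
      show "(\<lambda>n. (1 + \<tau>\<^sup>2) * (?I P Q n / beta_mass t n)) \<longlonglongrightarrow> (1 + \<tau>\<^sup>2) * Re (form (geom_mean t P Q) x)"
        by (intro tendsto_mult tendsto_const lim_Re P Q)
      have "lam * (?I A C n / beta_mass t n) + (1 - lam) * (?I B D n / beta_mass t n) \<le> (1 + \<tau>\<^sup>2) * (?I P Q n / beta_mass t n)" for n
      proof -
        have "lam * ?I A C n + (1 - lam) * ?I B D n
          = integral (S n) (\<lambda>s. lam * (beta_weight t s * Re (form (har_mean s A C) x))
              + (1 - lam) * (beta_weight t s * Re (form (har_mean s B D) x)))"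
          using acc by (simp add: integral_add integrable_on_mult_right int)
        also have "\<dots> \<le> integral (S n) (\<lambda>s. (1 + \<tau>\<^sup>2) * (beta_weight t s * Re (form (har_mean s P Q) x)))"
        proof (rule integral_le)
          fix s assume "s \<in> S n"
          note s = S[OF this]
          have "beta_weight t s * (lam * Re (form (har_mean s A C) x) + (1 - lam) * Re (form (har_mean s B D) x))
            \<le> beta_weight t s * ((1 + \<tau>\<^sup>2) * Re (form (har_mean s P Q) x))"
            by (intro mult_left_mono har(1) s beta_weight_nonneg)
          then show "lam * (beta_weight t s * Re (form (har_mean s A C) x))
              + (1 - lam) * (beta_weight t s * Re (form (har_mean s B D) x))
            \<le> (1 + \<tau>\<^sup>2) * (beta_weight t s * Re (form (har_mean s P Q) x))"
            by (simp add: algebra_simps)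
        qed (use acc P Q in \<open>auto intro!: integrable_add integrable_on_mult_right int\<close>)
        also have "\<dots> = (1 + \<tau>\<^sup>2) * ?I P Q n" by simp
        finally have "(lam * ?I A C n + (1 - lam) * ?I B D n) / beta_mass t n \<le> (1 + \<tau>\<^sup>2) * ?I P Q n / beta_mass t n"
          using beta_mass_pos[OF 3, of n] by (intro divide_right_mono) auto
        then show ?thesis by (simp add: add_divide_distrib)
      qed
      then show "\<exists>N. \<forall>n\<ge>N. lam * (?I A C n / beta_mass t n) + (1 - lam) * (?I B D n / beta_mass t n)
          \<le> (1 + \<tau>\<^sup>2) * (?I P Q n / beta_mass t n)" by blast
    qed
    ultimately show ?thesis by blast
  qed
qed

theorem theorem2p4:
  fixes A B C D :: "complex ^ 'n::finite ^ 'n" and \<alpha> t lam :: real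
  assumes "0 \<le> \<alpha>" and "\<alpha> < pi / 2"
    and "A \<in> sectorial \<alpha>" and "B \<in> sectorial \<alpha>" and "C \<in> sectorial \<alpha>" and "D \<in> sectorial \<alpha>"
    and "0 \<le> t" and "t \<le> 1" and "0 \<le> lam" and "lam \<le> 1"
  shows "loewner_le
    (real_part (lam *\<^sub>R geom_mean t A C + (1 - lam) *\<^sub>R geom_mean t B D))
    ((1 / (cos \<alpha>)\<^sup>2) *\<^sub>R
      geom_mean t (real_part (lam *\<^sub>R A + (1 - lam) *\<^sub>R B)) (real_part (lam *\<^sub>R C + (1 - lam) *\<^sub>R D)))"
proof -
  have cos: "cos \<alpha> > 0" using assms(1,2) by (intro cos_gt_zero_pi) auto
  have tan: "0 \<le> tan \<alpha>" using assms(1,2) by (cases "\<alpha> = 0") (auto intro!: less_imp_le tan_gt_zero)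
  have sec: "1 / (cos \<alpha>)\<^sup>2 = 1 + (tan \<alpha>)\<^sup>2"
    using tan_sec[of \<alpha>] cos by (simp add: power_inverse divide_inverse)
  have form_comb: "form (lam *\<^sub>R X + (1 - lam) *\<^sub>R Y) x = of_real lam * form X x + of_real (1 - lam) * form Y x"
    for X Y :: "'n cmat" and x
    by (simp only: matrix_vector_mult_add_rdistrib cmat_scaleR_mult_vec cinner_add_left cinner_scaleR_left)
  \<comment> \<open>Stated for arbitrary \<open>X\<close> and \<open>Y\<close>, because it is
    applied to the given matrices as well as to the two geometric means on the left-hand
    side.\<close>
  have form_re: "form (real_part (lam *\<^sub>R X + (1 - lam) *\<^sub>R Y)) x = of_real (lam * Re (form X x) + (1 - lam) * Re (form Y x))"
    for X Y :: "'n cmat" and x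
    by (simp add: form_real_part form_comb)
  have acc_comb: "accretive (real_part (lam *\<^sub>R X + (1 - lam) *\<^sub>R Y))"
    if "accretive X" "accretive Y" for X Y :: "'n cmat"
    unfolding accretive_def form_re
  proof (intro allI impI)
    fix x :: "complex ^ 'n" assume "x \<noteq> 0"
    then have "0 < Re (form X x)" "0 < Re (form Y x)" using that by (auto simp: accretive_def)
    \<comment> \<open>Strictness comes from the second term if \<open>lam = 0\<close> and from the
      first otherwise.\<close>
    then show "0 < Re (of_real (lam * Re (form X x) + (1 - lam) * Re (form Y x)))"
      using assms(9,10) by (cases "lam = 0") (auto intro!: add_pos_nonneg)
  qed
  note acc = sectorial_imp(1)[OF assms(3)] sectorial_imp(1)[OF assms(4)]
    sectorial_imp(1)[OF assms(5)] sectorial_imp(1)[OF assms(6)]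
  note key = geom_mean_real_part[OF acc sectorial_imp(2)[OF assms(3)] sectorial_imp(2)[OF assms(4)]
    sectorial_imp(2)[OF assms(5)] sectorial_imp(2)[OF assms(6)] tan assms(9,10,7,8)
    acc_comb[OF acc(1,2)] form_re acc_comb[OF acc(3,4)] form_re]
  show ?thesis
    using key by (intro loewner_leI) (simp_all add: form_re cmat_scaleR_mult_vec sec)
qed

end
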